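(* Let $c^{*}\in\partial C$ be a nondegenerate critical point of the thickness function $d$. Then, in local coordinates on $\partial C$ centered at $c^{*}$, the return map $F$ admits the expansion $$F(c)=c-A(c^{*})\nabla_{\partial C}d(c)+R(c),$$ where $\|R(c)\|=o(\|c-c^{*}\|)$ as $c\to c^{*}$, and the linear operator $A(c^{*}):T_{c^{*}}(\partial C)\to T_{c^{*}}(\partial C)$ is defined by $$A(c^{*})=(I-DF(c^{*}))\bigl(\operatorname{Hess}_{\partial C}(d)(c^{*})\bigr)^{-1}.$$
   Context: Setting. $C\subset\mathbb{R}^N$ is a compact convex set with nonempty interior whose boundary $\partial C$ is a compact manifold of class $C^2$, with outward unit normal $\nu$. $\Omega\subset\mathbb{R}^N$ is a bounded domain containing $C$ and belonging to the class $\mathcal{O}_C$: for almost every $x\in\partial\Omega$ where the inward unit normal $n(x)$ to $\partial\Omega$ exists, the half-line $D(x,n(x))=\{x+tn(x):t\ge 0\}$ intersects $C$. Thickness function: $d:\partial C\to\mathbb{R}_+$, $d(c)=\sup\{r\ge 0: c+r\nu(c)\in\Omega\}$, assumed of class $C^2$. Radial map: $\Phi(c)=c+d(c)\nu(c)$, which parametrizes $\partial\Omega\setminus C$ by $\partial C$. Reciprocal map $\pi$: for $x\in\partial\Omega$, $\pi(x)\in\partial C$ is the point of $\partial C$ reached when one moves from $x$ along the half-line $D(x,n(x))$ back to $\partial C$ (its first point in $C$). Return map: $F=\pi\circ\Phi:\partial C\to\partial C$; in this setting $F$ is of class $C^1$, and $DF(c^* )$ is its differential. Critical points of $d$ are fixed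 points of $F$. $\nabla_{\partial C}$ is the tangential gradient and $\operatorname{Hess}_{\partial C}(d)$ the intrinsic Hessian, viewed at $c^*$ as a linear operator on $T_{c^*}(\partial C)$. A critical point is nondegenerate if this Hessian is invertible. In local coordinates centered at $c^*$, points of $\partial C$ near $c^*$ and tangent vectors there are identified with vectors in $T_{c^*}(\partial C)$, and $\|\cdot\|$ is the norm on this space. *)

theory Defs
  imports "HOL-Analysis.Analysis" "HOL-Library.Landau_Symbols"
begin

section \<open>Smooth maps and embedded manifolds\<close>

definition C1_open :: "('a::real_normed_vector \<Rightarrow> 'b::real_normed_vector) \<Rightarrow> 'a set \<Rightarrow> bool" where
  "C1_open f U \<longleftrightarrow> open U \<and>
     (\<exists>f' :: 'a \<Rightarrow> ('a \<Rightarrow>\<^sub>L 'b).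
        (\<forall>x\<in>U. (f has_derivative blinfun_apply (f' x)) (at x)) \<and> continuous_on U f')"

definition C2_open :: "('a::real_normed_vector \<Rightarrow> 'b::real_normed_vector) \<Rightarrow> 'a set \<Rightarrow> bool" where
  "C2_open f U \<longleftrightarrow> open U \<and>
     (\<exists>f' :: 'a \<Rightarrow> ('a \<Rightarrow>\<^sub>L 'b).
        (\<forall>x\<in>U. (f has_derivative blinfun_apply (f' x)) (at x)) \<and> C1_open f' U)"

text \<open>
  A map on an arbitrary subset \<open>S\<close> of a Euclidean space is of class \<open>C\<^sup>k\<close> if near each point
  of \<open>S\<close> it extends to a \<open>C\<^sup>k\<close> map on an open subset of the ambient space.  For \<open>S\<close> an embedded
  \<open>C\<^sup>2\<close> submanifold and \<open>k \<le> 2\<close> this is the usual notion.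
\<close>

definition C1_on :: "'a::real_normed_vector set \<Rightarrow> ('a \<Rightarrow> 'b::real_normed_vector) \<Rightarrow> bool" where
  "C1_on S f \<longleftrightarrow> (\<forall>x\<in>S. \<exists>U g. x \<in> U \<and> C1_open g U \<and> (\<forall>y\<in>S \<inter> U. g y = f y))"

definition C2_on :: "'a::real_normed_vector set \<Rightarrow> ('a \<Rightarrow> 'b::real_normed_vector) \<Rightarrow> bool" where
  "C2_on S f \<longleftrightarrow> (\<forall>x\<in>S. \<exists>U g. x \<in> U \<and> C2_open g U \<and> (\<forall>y\<in>S \<inter> U. g y = f y))"

definition C2_diffeo ::
  "'a::real_normed_vector set \<Rightarrow> 'b::real_normed_vector set \<Rightarrow> ('a \<Rightarrow> 'b) \<Rightarrow> bool" where
  "C2_diffeo S W \<phi> \<longleftrightarrow> bij_betw \<phi> S W \<and> C2_on S \<phi> \<and> C2_on W (inv_into S \<phi>)"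

text \<open>The model space \<open>\<real>\<^sup>k\<close> is realised as a \<open>k\<close>-dimensional linear subspace \<open>H\<close> of the ambient space.\<close>

definition C2_manifold :: "nat \<Rightarrow> 'a::euclidean_space set \<Rightarrow> bool" where
  "C2_manifold k M \<longleftrightarrow>
     (\<forall>p\<in>M. \<exists>U H W. \<exists>\<phi> :: 'a \<Rightarrow> 'a. open U \<and> p \<in> U \<and> subspace H \<and> dim H = k \<and>
        openin (top_of_set H) W \<and> C2_diffeo (M \<inter> U) W \<phi>)"

definition tangent_space :: "'a::euclidean_space set \<Rightarrow> 'a \<Rightarrow> 'a set" where
  "tangent_space M p =
     {v. \<exists>\<gamma> :: real \<Rightarrow> 'a. \<gamma> 0 = p \<and> (\<forall>\<^sub>F t in nhds 0. \<gamma> t \<in> M) \<and>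
           (\<gamma> has_vector_derivative v) (at 0)}"

text \<open>
  On a submanifold \<open>M\<close> the differential of \<open>f\<close> at \<open>p\<close> is the derivative of \<open>f\<close> at \<open>p\<close> within \<open>M\<close>.
  It is determined only on the tangent space of \<open>M\<close> at \<open>p\<close>, and is used below only there.
\<close>

definition surface_deriv ::
  "'a::euclidean_space set \<Rightarrow> ('a \<Rightarrow> 'b::real_normed_vector) \<Rightarrow> 'a \<Rightarrow> 'a \<Rightarrow> 'b" where
  "surface_deriv M f p = frechet_derivative f (at p within M)"

definition surface_grad :: "'a::euclidean_space set \<Rightarrow> ('a \<Rightarrow> real) \<Rightarrow> 'a \<Rightarrow> 'a" where
  "surface_grad M f p =
     (THE g. g \<in> tangent_space M p \<and> (\<forall>v\<in>tangent_space M p. g \<bullet> v = surface_deriv M f p v))"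

text \<open>
  The intrinsic Hessian as an operator, \<open>v \<mapsto> \<nabla>\<^sub>v (grad f)\<close>: the Levi-Civita connection of an
  embedded submanifold is the tangential part of the ambient derivative, and \<open>closest_point\<close> is
  the orthogonal projection onto the tangent space.
\<close>

definition surface_hess :: "'a::euclidean_space set \<Rightarrow> ('a \<Rightarrow> real) \<Rightarrow> 'a \<Rightarrow> 'a \<Rightarrow> 'a" where
  "surface_hess M f p v =
     closest_point (tangent_space M p) (surface_deriv M (surface_grad M f) p v)"

definition nondegenerate_critical_point ::
  "'a::euclidean_space set \<Rightarrow> ('a \<Rightarrow> real) \<Rightarrow> 'a \<Rightarrow> bool" where
  "nondegenerate_critical_point M f p \<longleftrightarrow> p \<in> M \<and> surface_grad M f p = 0 \<and>
     bij_betw (surface_hess M f p) (tangent_space M p) (tangent_space M p)"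

text \<open>
  Local coordinates on \<open>M \<inter> U\<close> centered at \<open>p\<close> with values in the tangent space at \<open>p\<close>.  The last
  clause says that tangent vectors at \<open>p\<close> itself are identified with themselves; a tangent vector
  \<open>w\<close> at \<open>c \<in> M \<inter> U\<close> is identified with \<open>surface_deriv M \<phi> c w\<close>.
\<close>

definition local_coordinates ::
  "'a::euclidean_space set \<Rightarrow> 'a \<Rightarrow> 'a set \<Rightarrow> ('a \<Rightarrow> 'a) \<Rightarrow> bool" where
  "local_coordinates M p U \<phi> \<longleftrightarrow> open U \<and> p \<in> M \<inter> U \<and>
     openin (top_of_set (tangent_space M p)) (\<phi> ` (M \<inter> U)) \<and>
     C2_diffeo (M \<inter> U) (\<phi> ` (M \<inter> U)) \<phi> \<and> \<phi> p = 0 \<and>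
     (\<forall>v\<in>tangent_space M p. surface_deriv M \<phi> p v = v)"


section \<open>Surface measure zero and unit normals\<close>

text \<open>
  Hausdorff outer measure of integer dimension \<open>k\<close>, without the customary normalising factor, which
  does not affect null sets.  For \<open>k = 0\<close> nonempty sets have weight \<open>0 ^ 0 = 1\<close>.
\<close>

definition hausdorff_weight :: "nat \<Rightarrow> 'a::metric_space set \<Rightarrow> ennreal" where
  "hausdorff_weight k S = (if S = {} then 0 else ennreal (diameter S ^ k))"

definition hausdorff_outer :: "nat \<Rightarrow> 'a::metric_space set \<Rightarrow> ennreal" where
  "hausdorff_outer k A =
     (SUP \<delta>\<in>{0<..}. INF U\<in>{U :: nat \<Rightarrow> 'a set. A \<subseteq> (\<Union>i. U i) \<and>
        (\<forall>i. bounded (U i) \<and> diameter (U i) \<le> \<delta>)}. \<Sum>i. hausdorff_weight k (U i))"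

text \<open>
  \<open>n\<close> is the inward unit normal to the boundary of \<open>S\<close> at \<open>x\<close> if, to first order at \<open>x\<close>, \<open>S\<close> is the
  half-space \<open>{y. (y - x) \<bullet> n > 0}\<close>.  No regularity of the boundary is presupposed, and at
  nonsmooth points no such \<open>n\<close> need exist; there is at most one.
\<close>

definition is_inward_normal :: "'a::euclidean_space set \<Rightarrow> 'a \<Rightarrow> 'a \<Rightarrow> bool" where
  "is_inward_normal S x n \<longleftrightarrow> x \<in> frontier S \<and> norm n = 1 \<and>
     (\<forall>\<epsilon>>0. \<forall>\<^sub>F y in nhds x.
        ((y - x) \<bullet> n > \<epsilon> * norm (y - x) \<longrightarrow> y \<in> S) \<and>
        ((y - x) \<bullet> n < - \<epsilon> * norm (y - x) \<longrightarrow> y \<notin> S))"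

definition inward_normal :: "'a::euclidean_space set \<Rightarrow> 'a \<Rightarrow> 'a" where
  "inward_normal S x = (THE n. is_inward_normal S x n)"

definition outward_normal :: "'a::euclidean_space set \<Rightarrow> 'a \<Rightarrow> 'a" where
  "outward_normal S x = - inward_normal S x"


section \<open>Thickness function and return map\<close>

definition half_line :: "'a::euclidean_space \<Rightarrow> 'a \<Rightarrow> 'a set" where
  "half_line x n = {x + t *\<^sub>R n | t. t \<ge> 0}"

definition class_O :: "'a::euclidean_space set \<Rightarrow> 'a set \<Rightarrow> bool" where
  "class_O C \<Omega> \<longleftrightarrow>
     hausdorff_outer (DIM('a) - 1)
       {x \<in> frontier \<Omega>. \<exists>n. is_inward_normal \<Omega> x n \<and> half_line x n \<inter> C = {}} = 0"

definition thickness :: "'a::euclidean_space set \<Rightarrow> 'a set \<Rightarrow> 'a \<Rightarrow> real" where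
  "thickness C \<Omega> c = Sup {r. r \<ge> 0 \<and> c + r *\<^sub>R outward_normal C c \<in> \<Omega>}"

definition radial_map :: "'a::euclidean_space set \<Rightarrow> 'a set \<Rightarrow> 'a \<Rightarrow> 'a" where
  "radial_map C \<Omega> c = c + thickness C \<Omega> c *\<^sub>R outward_normal C c"

definition reciprocal_map :: "'a::euclidean_space set \<Rightarrow> 'a set \<Rightarrow> 'a \<Rightarrow> 'a" where
  "reciprocal_map C \<Omega> x =
     x + Inf {t. t \<ge> 0 \<and> x + t *\<^sub>R inward_normal \<Omega> x \<in> C} *\<^sub>R inward_normal \<Omega> x"

definition return_map :: "'a::euclidean_space set \<Rightarrow> 'a set \<Rightarrow> 'a \<Rightarrow> 'a" where
  "return_map C \<Omega> = reciprocal_map C \<Omega> \<circ> radial_map C \<Omega>"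

definition return_operator :: "'a::euclidean_space set \<Rightarrow> 'a set \<Rightarrow> 'a \<Rightarrow> 'a \<Rightarrow> 'a" where
  "return_operator C \<Omega> p v =
     (let M = frontier C;
          w = inv_into (tangent_space M p) (surface_hess M (thickness C \<Omega>) p) v
      in w - surface_deriv M (return_map C \<Omega>) p w)"

end

theory Submission
  imports Defs
begin

text \<open>
  Every derivative is taken within the surface \<open>M = frontier C\<close>.  A chart provides a
  differentiable local retraction \<open>\<rho>\<close> onto \<open>M\<close>; its derivative at \<open>p\<close> projects onto the tangent space
  and is itself a derivative of the identity within \<open>M\<close>, so that derivatives within \<open>M\<close> may be
  composed with it and are then determined by their values on tangent vectors.

  Since \<open>\<Omega>\<close> is the set of points whose distance to \<open>C\<close> is less than the thickness at the closest
  point, at a critical point \<open>c\<^sub>0\<close> of the thickness the normal of \<open>\<Omega>\<close> at \<open>\<Phi>(c\<^sub>0)\<close> is the normal of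
  \<open>C\<close> at \<open>c\<^sub>0\<close>, and \<open>F(c\<^sub>0) = c\<^sub>0\<close>.  The gradient vanishes at \<open>c\<^sub>0\<close>, so its derivative there takes
  tangential values and equals the Hessian.  Hence \<open>A(c\<^sub>0)\<close> applied to the gradient has derivative
  \<open>I - DF(c\<^sub>0)\<close>, which cancels that of \<open>F - id\<close>: the remainder has derivative zero.
\<close>

section \<open>Differentiation within embedded submanifolds\<close>

lemma has_derivative_transform_open_within:
  assumes "(f has_derivative f') (at x within S)" "open V" "x \<in> V" "x \<in> S"
    and "\<And>y. y \<in> S \<Longrightarrow> y \<in> V \<Longrightarrow> f y = g y"
  shows "(g has_derivative f') (at x within S)"
proof -
  obtain e where "e > 0" "ball x e \<subseteq> V"
    using assms(2,3) openE by blast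
  then show ?thesis
    using has_derivative_transform_within[OF assms(1), of e g] assms(4,5)
    by (force simp: dist_commute)
qed

lemma tangent_spaceE:
  assumes "v \<in> tangent_space M p"
  obtains \<gamma> S where "open S" "0 \<in> S" "\<gamma> ` S \<subseteq> M" "\<gamma> 0 = p" "(\<gamma> has_vector_derivative v) (at 0)"
  using assms unfolding tangent_space_def eventually_nhds by (force intro: that)

lemma has_vector_derivative_compose_curve:
  assumes "open S" "0 \<in> S" "\<gamma> ` S \<subseteq> M" "(\<gamma> has_vector_derivative v) (at 0)"
    and f: "(f has_derivative f') (at (\<gamma> 0) within M)"
  shows "(f \<circ> \<gamma> has_vector_derivative f' v) (at 0)"
proof -
  have S: "at 0 within S = at 0"
    using assms at_within_open by blast
  have "(f has_derivative f') (at (\<gamma> 0) within \<gamma> ` S)"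
    using f assms(3) by (rule has_derivative_subset)
  then have "(f \<circ> \<gamma> has_derivative f' \<circ> (\<lambda>t. t *\<^sub>R v)) (at 0 within S)"
    using assms(4) S unfolding has_vector_derivative_def by (intro diff_chain_within) simp_all
  moreover have "f' \<circ> (\<lambda>t. t *\<^sub>R v) = (\<lambda>t. t *\<^sub>R f' v)"
    using has_derivative_linear[OF f] by (auto simp: linear_cmul)
  ultimately show ?thesis
    using S unfolding has_vector_derivative_def by simp
qed

lemma surface_deriv_works:
  "f differentiable (at p within M) \<Longrightarrow> (f has_derivative surface_deriv M f p) (at p within M)"
  unfolding surface_deriv_def using frechet_derivative_works by blast

text \<open>Derivatives within \<open>M\<close> may differ in directions transversal to
  \<open>M\<close>. A tangent vector is the velocity of a curve in \<open>M\<close>, and the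
  derivative of \<open>f\<close> along that curve is a derivative in one real variable, hence
  unique.\<close>

lemma has_derivative_unique_on_tangent_space:
  assumes "(f has_derivative f') (at p within M)" "(f has_derivative f'') (at p within M)"
    and "v \<in> tangent_space M p"
  shows "f' v = f'' v"
proof -
  obtain \<gamma> S where g: "open S" "0 \<in> S" "\<gamma> ` S \<subseteq> M" "\<gamma> 0 = p" "(\<gamma> has_vector_derivative v) (at 0)"
    using tangent_spaceE[OF assms(3)] .
  note d = has_vector_derivative_compose_curve[OF g(1-3,5), unfolded g(4)]
  show ?thesis
    using vector_derivative_unique_at[OF d[OF assms(1)] d[OF assms(2)]] .
qed

lemma surface_deriv_eq:
  assumes "(f has_derivative f') (at p within M)" "v \<in> tangent_space M p"
  shows "surface_deriv M f p v = f' v"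
  using has_derivative_unique_on_tangent_space surface_deriv_works differentiableI assms by metis

text \<open>The image under \<open>f\<close> of a curve in \<open>M\<close> is a curve in
  \<open>N\<close>, and its velocity is \<open>f' v\<close>.\<close>

lemma has_derivative_into_tangent_space:
  assumes "(f has_derivative f') (at p within M)" "v \<in> tangent_space M p" "f ` M \<subseteq> N"
  shows "f' v \<in> tangent_space N (f p)"
proof -
  obtain \<gamma> S where g: "open S" "0 \<in> S" "\<gamma> ` S \<subseteq> M" "\<gamma> 0 = p" "(\<gamma> has_vector_derivative v) (at 0)"
    using tangent_spaceE[OF assms(2)] .
  note d = has_vector_derivative_compose_curve[OF g(1-3,5), unfolded g(4), OF assms(1)]
  have "\<forall>\<^sub>F t in nhds 0. (f \<circ> \<gamma>) t \<in> N"
    unfolding eventually_nhds using g assms(3) by (intro exI[of _ S]) auto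
  then show ?thesis
    unfolding tangent_space_def using g d by (intro CollectI exI[of _ "f \<circ> \<gamma>"]) simp
qed

text \<open>A linear projection onto \<open>H\<close> agrees with the identity on \<open>M\<close>,
  so both are derivatives of the identity within \<open>M\<close> and coincide on tangent
  vectors.\<close>

lemma tangent_space_subset_subspace:
  fixes H :: "'a::euclidean_space set"
  assumes "subspace H" "M \<subseteq> H"
  shows "tangent_space M p \<subseteq> H"
proof
  fix v assume v: "v \<in> tangent_space M p"
  then have "p \<in> M"
    by (force elim: tangent_spaceE)
  obtain P :: "'a \<Rightarrow> 'a" where P: "linear P" "range P \<subseteq> H" "\<And>v. v \<in> H \<Longrightarrow> P v = v"
    using linear_exists_left_inverse_on[OF linear_ident assms(1)] by auto
  have "(P has_derivative P) (at p within M)"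
    using P(1) by (simp add: linear_conv_bounded_linear bounded_linear_imp_has_derivative)
  then have "((\<lambda>x. x) has_derivative P) (at p within M)"
    by (rule has_derivative_transform_open_within[OF _ open_UNIV _ \<open>p \<in> M\<close>]) (use P assms in auto)
  then have "P v = v"
    using has_derivative_unique_on_tangent_space[OF _ has_derivative_ident v] by blast
  then show "v \<in> H"
    using P(2) by (metis rangeI subsetD)
qed

text \<open>A twice differentiable retraction. The derivative is carried as a function into bounded
  linear maps so that it can itself be differentiated in the base point. The values of
  \<open>\<rho>\<close> lie in \<open>M\<close> but may leave \<open>V\<close>.\<close>

definition local_retraction ::
  "'a::euclidean_space set \<Rightarrow> 'a set \<Rightarrow> ('a \<Rightarrow> 'a) \<Rightarrow> ('a \<Rightarrow> 'a \<Rightarrow>\<^sub>L 'a) \<Rightarrow> bool" where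
  "local_retraction M V \<rho> \<rho>' \<longleftrightarrow> open V \<and> (\<forall>x\<in>M \<inter> V. \<rho> x = x) \<and>
     (\<forall>x\<in>V. \<rho> x \<in> M \<and> (\<rho> has_derivative blinfun_apply (\<rho>' x)) (at x) \<and> \<rho>' differentiable at x)"

text \<open>On \<open>M\<close> the retraction is the identity, so \<open>\<rho>' c\<close> is a
  derivative of the identity within \<open>M\<close> and fixes tangent vectors. Conversely, every
  \<open>\<rho>' c v\<close> is tangent, being the velocity of the curve
  \<open>\<rho> (c + t v)\<close> in \<open>M\<close>.\<close>

lemma
  fixes M :: "'a::euclidean_space set"
  assumes "local_retraction M V \<rho> \<rho>'" "c \<in> M" "c \<in> V"
  shows local_retraction_fixes: "\<And>v. v \<in> tangent_space M c \<Longrightarrow> \<rho>' c v = v"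
    and local_retraction_range: "range (\<rho>' c) = tangent_space M c"
    and local_retraction_id: "((\<lambda>x. x) has_derivative \<rho>' c) (at c within M)"
proof -
  have V: "open V" and \<rho>: "\<And>x. x \<in> M \<inter> V \<Longrightarrow> \<rho> x = x" "\<And>x. x \<in> V \<Longrightarrow> \<rho> x \<in> M"
    "(\<rho> has_derivative \<rho>' c) (at c)"
    using assms by (auto simp: local_retraction_def)
  have "(\<rho> has_derivative \<rho>' c) (at c within M)"
    using \<rho>(3) by (rule has_derivative_at_withinI)
  then show id: "((\<lambda>x. x) has_derivative \<rho>' c) (at c within M)"
    by (rule has_derivative_transform_open_within[OF _ V \<open>c \<in> V\<close> \<open>c \<in> M\<close>]) (use \<rho> in auto)
  show fixed: "\<rho>' c v = v" if "v \<in> tangent_space M c" for v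
    using has_derivative_unique_on_tangent_space[OF id has_derivative_ident that] .
  have "\<rho>' c v \<in> tangent_space M c" for v
  proof -
    have c: "((\<lambda>t. c + t *\<^sub>R v) has_derivative (\<lambda>t. t *\<^sub>R v)) (at 0)"
      by (auto intro!: derivative_eq_intros)
    have "((\<lambda>t. \<rho> (c + t *\<^sub>R v)) has_derivative (\<lambda>t. \<rho>' c (t *\<^sub>R v))) (at 0)"
      using has_derivative_compose[OF c, of \<rho> "\<rho>' c"] \<rho>(3) by simp
    then have d: "((\<lambda>t. \<rho> (c + t *\<^sub>R v)) has_vector_derivative \<rho>' c v) (at 0)"
      by (simp add: has_vector_derivative_def blinfun.scaleR_right)
    have "((\<lambda>t. c + t *\<^sub>R v) \<longlongrightarrow> c) (nhds 0)"
      by (rule tendsto_eq_intros refl filterlim_ident | simp)+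
    then have "\<forall>\<^sub>F t in nhds 0. c + t *\<^sub>R v \<in> V"
      using V \<open>c \<in> V\<close> topological_tendstoD by blast
    then have "\<forall>\<^sub>F t in nhds 0. \<rho> (c + t *\<^sub>R v) \<in> M"
      by eventually_elim (rule \<rho>)
    with d show ?thesis
      unfolding tangent_space_def using \<rho>(1) assms by (intro CollectI exI[of _ "\<lambda>t. \<rho> (c + t *\<^sub>R v)"]) auto
  qed
  then show "range (\<rho>' c) = tangent_space M c"
    using fixed by (auto simp: image_iff) metis
qed

lemma C2_openD:
  assumes "C2_open f U"
  obtains f' where "open U" "\<And>x. x \<in> U \<Longrightarrow> (f has_derivative blinfun_apply (f' x)) (at x)"
    "\<And>x. x \<in> U \<Longrightarrow> f' differentiable at x"
  using assms unfolding C2_open_def C1_open_def differentiable_def by metis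

text \<open>The retraction is the chart, followed by a linear projection onto \<open>H\<close>,
  followed by the inverse chart, with both charts replaced by their smooth extensions
  \<open>f\<close> and \<open>g\<close>. The projection is needed because \<open>f\<close> may leave
  \<open>H\<close> off \<open>M\<close>, while \<open>g\<close> inverts the chart only on
  \<open>W\<close>.\<close>

lemma C2_manifold_local_retraction:
  fixes M :: "'a::euclidean_space set"
  assumes "C2_manifold k M" "p \<in> M"
  obtains V \<rho> \<rho>' where "local_retraction M V \<rho> \<rho>'" "p \<in> V" "k \<le> dim (tangent_space M p)"
proof -
  obtain U H W and \<phi> :: "'a \<Rightarrow> 'a" where U: "open U" "p \<in> U" and H: "subspace H" "dim H = k"
    and W: "openin (top_of_set H) W" and \<phi>: "C2_diffeo (M \<inter> U) W \<phi>"
    using assms unfolding C2_manifold_def by blast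
  define \<psi> where "\<psi> = inv_into (M \<inter> U) \<phi>"
  have bij: "bij_betw \<phi> (M \<inter> U) W" and \<psi>\<phi>: "\<And>x. x \<in> M \<inter> U \<Longrightarrow> \<psi> (\<phi> x) = x"
    and \<psi>M: "\<And>y. y \<in> W \<Longrightarrow> \<psi> y \<in> M \<inter> U" and \<phi>\<psi>: "\<And>y. y \<in> W \<Longrightarrow> \<phi> (\<psi> y) = y"
    using \<phi> bij_betwE[OF bij_betw_inv_into] bij_betw_inv_into_left bij_betw_inv_into_right
    unfolding C2_diffeo_def \<psi>_def by fastforce+
  have qW: "\<phi> p \<in> W" and W_H: "W \<subseteq> H"
    using bij assms U openin_imp_subset[OF W] by (auto simp: bij_betw_def)
  obtain U1 f where f: "p \<in> U1" "C2_open f U1" "\<And>y. y \<in> M \<inter> U \<inter> U1 \<Longrightarrow> f y = \<phi> y"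
    using \<phi> assms U unfolding C2_diffeo_def C2_on_def by (metis IntI)
  obtain U2 g where g: "\<phi> p \<in> U2" "C2_open g U2" "\<And>y. y \<in> W \<inter> U2 \<Longrightarrow> g y = \<psi> y"
    using \<phi> qW unfolding C2_diffeo_def C2_on_def \<psi>_def by metis
  obtain f' where f': "open U1" "\<And>x. x \<in> U1 \<Longrightarrow> (f has_derivative blinfun_apply (f' x)) (at x)"
    "\<And>x. x \<in> U1 \<Longrightarrow> f' differentiable at x"
    using C2_openD[OF f(2)] by blast
  obtain g' where g': "open U2" "\<And>x. x \<in> U2 \<Longrightarrow> (g has_derivative blinfun_apply (g' x)) (at x)"
    "\<And>x. x \<in> U2 \<Longrightarrow> g' differentiable at x"
    using C2_openD[OF g(2)] by blast
  obtain O2 where O2: "open O2" "W = H \<inter> O2"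
    using W by (auto simp: openin_open)
  obtain P0 :: "'a \<Rightarrow> 'a" where P0: "linear P0" "range P0 \<subseteq> H" "\<And>v. v \<in> H \<Longrightarrow> P0 v = v"
    using linear_exists_left_inverse_on[OF linear_ident H(1)] by auto
  define P where "P = Blinfun P0"
  have P: "blinfun_apply P = P0"
    unfolding P_def using P0(1) by (simp add: bounded_linear_Blinfun_apply linear_conv_bounded_linear)
  have fp: "f p = \<phi> p" "P0 (f p) = \<phi> p"
    using f(1,3) assms U P0(3) qW W_H by auto
  have contf: "continuous_on U1 f"
    using f' by (intro continuous_at_imp_continuous_on) (blast intro: has_derivative_continuous)
  have contP: "continuous_on U1 (\<lambda>x. P0 (f x))"
    using continuous_on_compose2[OF linear_continuous_on[OF P0(1)[unfolded linear_conv_bounded_linear]] contf subset_UNIV] .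
  define V where "V = U1 \<inter> U \<inter> (\<lambda>x. P0 (f x)) -` (U2 \<inter> O2)"
  have V: "open V"
  proof -
    have "open ((\<lambda>x. P0 (f x)) -` (U2 \<inter> O2) \<inter> U1)"
      using contP f'(1) g'(1) O2(1) continuous_on_open_vimage by blast
    moreover have "V = (\<lambda>x. P0 (f x)) -` (U2 \<inter> O2) \<inter> U1 \<inter> U"
      by (auto simp: V_def)
    ultimately show ?thesis
      using U by auto
  qed
  have pV: "p \<in> V"
    using f U fp g qW O2 by (simp add: V_def)
  define \<rho> where "\<rho> x = g (P0 (f x))" for x
  define \<rho>' where "\<rho>' x = g' (P0 (f x)) o\<^sub>L (P o\<^sub>L f' x)" for x
  have "\<rho> x = x" if "x \<in> M \<inter> V" for x
  proof -
    have "f x = \<phi> x" "\<phi> x \<in> W"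
      using that f(3) bij_betwE[OF bij] by (auto simp: V_def)
    moreover from this have "P0 (f x) = \<phi> x"
      using P0(3) W_H by auto
    ultimately show ?thesis
      using that g(3) \<psi>\<phi> by (auto simp: V_def \<rho>_def)
  qed
  moreover have "\<rho> x \<in> M" if "x \<in> V" for x
  proof -
    have "P0 (f x) \<in> W \<inter> U2"
      using that P0(2) O2 by (auto simp: V_def)
    then show ?thesis
      using g(3) \<psi>M by (simp add: \<rho>_def)
  qed
  moreover have Pf: "((\<lambda>x. P0 (f x)) has_derivative blinfun_apply (P o\<^sub>L f' x)) (at x)" if "x \<in> V" for x
    using has_derivative_compose[OF f'(2) blinfun.bounded_linear_right[THEN bounded_linear_imp_has_derivative], of x P] that
    by (simp add: V_def P blinfun_compose.rep_eq o_def)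
  moreover have "(\<rho> has_derivative \<rho>' x) (at x)" if "x \<in> V" for x
    using has_derivative_compose[OF Pf[OF that] g'(2)] that
    by (simp add: \<rho>_def[abs_def] \<rho>'_def V_def blinfun_compose.rep_eq o_def)
  moreover have "\<rho>' differentiable at x" if "x \<in> V" for x
  proof -
    have "g' \<circ> (\<lambda>x. P0 (f x)) differentiable at x"
      using Pf[OF that] g'(3) that
      by (intro differentiable_chain_at) (auto simp: V_def differentiable_def)
    then obtain D1 where D1: "((\<lambda>x. g' (P0 (f x))) has_derivative D1) (at x)"
      by (auto simp: differentiable_def o_def)
    obtain D2 where D2: "(f' has_derivative D2) (at x)"
      using f'(3)[of x] \<open>x \<in> V\<close> by (auto simp: V_def differentiable_def)
    note D3 = bounded_bilinear.FDERIV[OF bounded_bilinear_blinfun_compose has_derivative_const[of P] D2]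
    show ?thesis
      unfolding \<rho>'_def[abs_def] differentiable_def
      using bounded_bilinear.FDERIV[OF bounded_bilinear_blinfun_compose D1 D3] by blast
  qed
  ultimately have ret: "local_retraction M V \<rho> \<rho>'"
    using V by (simp add: local_retraction_def)
  \<comment> \<open>Near \<open>\<phi> p\<close> the composite of \<open>g\<close> and
    \<open>f\<close> is the identity on \<open>W\<close>, which is open in \<open>H\<close>.
    Differentiating along a line in direction \<open>v\<close> gives the claim, so
    \<open>g' (\<phi> p)\<close> is injective on \<open>H\<close>; this yields the dimension
    bound.\<close>
  have q: "f' p (g' (\<phi> p) v) = v" if "v \<in> H" for v
  proof -
    have c: "((\<lambda>t. \<phi> p + t *\<^sub>R v) has_derivative (\<lambda>t. t *\<^sub>R v)) (at 0)"
      by (auto intro!: derivative_eq_intros)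
    have gq: "g (\<phi> p) = p"
      using g(1,3) qW \<psi>\<phi> assms U by auto
    have d1: "((\<lambda>t. g (\<phi> p + t *\<^sub>R v)) has_derivative (\<lambda>t. g' (\<phi> p) (t *\<^sub>R v))) (at 0)"
      using has_derivative_compose[OF c, of g "g' (\<phi> p)"] g' g(1) by simp
    have d2: "((\<lambda>t. f (g (\<phi> p + t *\<^sub>R v))) has_derivative (\<lambda>t. f' p (g' (\<phi> p) (t *\<^sub>R v)))) (at 0)"
      using has_derivative_compose[OF d1, of f "f' p"] f' f(1) gq by simp
    have lim: "((\<lambda>t. \<phi> p + t *\<^sub>R v) \<longlongrightarrow> \<phi> p) (at 0)"
      by (rule tendsto_eq_intros refl filterlim_ident | simp)+
    have lim2: "((\<lambda>t. g (\<phi> p + t *\<^sub>R v)) \<longlongrightarrow> p) (at 0)"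
      using has_derivative_continuous[OF d1] gq by (simp add: continuous_within)
    have "\<forall>\<^sub>F t in at 0. \<phi> p + t *\<^sub>R v \<in> U2 \<inter> O2"
      by (rule topological_tendstoD[OF lim]) (use g'(1) O2 g(1) qW in auto)
    moreover have "\<forall>\<^sub>F t in at 0. g (\<phi> p + t *\<^sub>R v) \<in> U1"
      using topological_tendstoD[OF lim2 f'(1) f(1)] .
    ultimately have "\<forall>\<^sub>F t in at 0. f (g (\<phi> p + t *\<^sub>R v)) = \<phi> p + t *\<^sub>R v"
    proof eventually_elim
      case (elim t)
      have "\<phi> p + t *\<^sub>R v \<in> W \<inter> U2"
        using elim O2 H that qW W_H by (auto intro: subspace_add subspace_scale)
      then show ?case
        using elim g(3) f(3) \<psi>M \<phi>\<psi> by auto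
    qed
    then have "((\<lambda>t. \<phi> p + t *\<^sub>R v) has_derivative (\<lambda>t. f' p (g' (\<phi> p) (t *\<^sub>R v)))) (at 0)"
      by (rule has_derivative_transform_eventually[OF d2]) (simp_all add: gq fp)
    then have "(\<lambda>t. t *\<^sub>R v) = (\<lambda>t. f' p (g' (\<phi> p) (t *\<^sub>R v)))"
      using c has_derivative_unique by blast
    from fun_cong[OF this, of 1] show ?thesis
      by simp
  qed
  have "g' (\<phi> p) ` H \<subseteq> tangent_space M p"
  proof safe
    fix v assume v: "v \<in> H"
    \<comment> \<open>A vector fixed by \<open>\<rho>' p\<close> lies in its range, which is the
      tangent space.\<close>
    have "\<rho>' p (g' (\<phi> p) v) = g' (\<phi> p) v"
      using q[OF v] P0(3)[OF v] fp by (simp add: \<rho>'_def P)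
    then show "g' (\<phi> p) v \<in> tangent_space M p"
      using local_retraction_range[OF ret \<open>p \<in> M\<close> pV] by (metis rangeI)
  qed
  moreover have "dim (g' (\<phi> p) ` H) = dim H"
  proof (rule dim_image_eq)
    show "linear (blinfun_apply (g' (\<phi> p)))"
      by (simp add: blinfun.bounded_linear_right bounded_linear.linear)
    show "inj_on (g' (\<phi> p)) (span H)"
      using q H(1) by (metis inj_onI span_eq_iff)
  qed
  ultimately have "k \<le> dim (tangent_space M p)"
    using H(2) dim_subset by metis
  with ret pV that show ?thesis by blast
qed

lemma tangent_space_Int_open:
  assumes "open U" "p \<in> U"
  shows "tangent_space M p \<subseteq> tangent_space (M \<inter> U) p"
proof
  fix v assume "v \<in> tangent_space M p"
  then obtain \<gamma> where g: "\<gamma> 0 = p" "\<forall>\<^sub>F t in nhds 0. \<gamma> t \<in> M" "(\<gamma> has_vector_derivative v) (at 0)"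
    by (auto simp: tangent_space_def)
  have "isCont \<gamma> 0"
    using g(3) has_vector_derivative_continuous by blast
  then have "(\<gamma> \<longlongrightarrow> p) (nhds 0)"
    using g(1) tendsto_at_iff_tendsto_nhds[of \<gamma> 0] by (simp add: isCont_def)
  then have "\<forall>\<^sub>F t in nhds 0. \<gamma> t \<in> U"
    using assms topological_tendstoD by blast
  with g show "v \<in> tangent_space (M \<inter> U) p"
    by (auto simp: tangent_space_def eventually_conj_iff)
qed

lemma C2_on_has_derivative:
  fixes f :: "'a::real_normed_vector \<Rightarrow> 'b::real_normed_vector"
  assumes "C2_on S f" "p \<in> S"
  obtains U f' where "open U" "p \<in> U" "f' differentiable at p"
    "\<forall>x\<in>S \<inter> U. (f has_derivative blinfun_apply (f' x)) (at x within S)"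
proof -
  obtain U g where g: "p \<in> U" "C2_open g U" "\<And>y. y \<in> S \<inter> U \<Longrightarrow> g y = f y"
    using assms unfolding C2_on_def by metis
  obtain g' where g': "open U" "\<And>x. x \<in> U \<Longrightarrow> (g has_derivative blinfun_apply (g' x)) (at x)"
    "\<And>x. x \<in> U \<Longrightarrow> g' differentiable at x"
    using C2_openD[OF g(2)] by blast
  show ?thesis
  proof (rule that[OF g'(1) g(1) g'(3)[OF g(1)]], rule ballI)
    fix x assume x: "x \<in> S \<inter> U"
    then have "(g has_derivative blinfun_apply (g' x)) (at x within S)"
      using g'(2) by (blast intro: has_derivative_at_withinI)
    then show "(f has_derivative blinfun_apply (g' x)) (at x within S)"
      by (rule has_derivative_transform_open_within[OF _ g'(1)]) (use x g(3) in auto)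
  qed
qed

lemma C1_on_differentiable:
  assumes "C1_on S f" "p \<in> S"
  shows "f differentiable (at p within S)"
proof -
  obtain U g g' where g: "p \<in> U" "open U" "(g has_derivative g') (at p)" "\<And>y. y \<in> S \<inter> U \<Longrightarrow> g y = f y"
    using assms unfolding C1_on_def C1_open_def by metis
  have "(f has_derivative g') (at p within S)"
    by (rule has_derivative_transform_open_within[OF has_derivative_at_withinI[OF g(3)] g(2,1) assms(2)])
      (use g(4) in auto)
  then show ?thesis
    by (rule differentiableI)
qed

text \<open>Here \<open>r\<close> represents \<open>f'\<close> through the inner product, and the
  gradient is \<open>r\<close> minus its component along \<open>m\<close>. The vector
  \<open>m\<close> need not be a unit vector, so any nonvanishing normal field can be inserted when
  the gradient is differentiated.\<close>

lemma surface_grad_hyperplane: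
  fixes M :: "'a::euclidean_space set"
  assumes T: "tangent_space M p = {v. m \<bullet> v = 0}" and "m \<noteq> 0"
    and f: "(f has_derivative f') (at p within M)"
  defines "r \<equiv> \<Sum>b\<in>Basis. f' b *\<^sub>R b"
  shows "surface_grad M f p = r - (r \<bullet> m / (m \<bullet> m)) *\<^sub>R m"
    and "v \<in> tangent_space M p \<Longrightarrow> surface_grad M f p \<bullet> v = f' v"
    and "surface_grad M f p \<in> tangent_space M p"
proof -
  define g where "g = r - (r \<bullet> m / (m \<bullet> m)) *\<^sub>R m"
  have r: "r \<bullet> v = f' v" for v
  proof -
    have lin: "linear f'"
      using has_derivative_linear[OF f] .
    have "f' v = f' (\<Sum>b\<in>Basis. (v \<bullet> b) *\<^sub>R b)"
      by (simp add: euclidean_representation)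
    also have "\<dots> = (\<Sum>b\<in>Basis. (v \<bullet> b) * f' b)"
      by (simp add: linear_sum[OF lin] linear_cmul[OF lin])
    finally show ?thesis
      by (simp add: r_def inner_sum_left inner_sum_right inner_commute mult.commute)
  qed
  have gT: "g \<in> tangent_space M p"
    using \<open>m \<noteq> 0\<close> by (simp add: T g_def inner_diff inner_commute)
  have gv: "g \<bullet> v = f' v" if "v \<in> tangent_space M p" for v
    using that r by (simp add: T g_def inner_diff)
  have unique: "h = g" if "h \<in> tangent_space M p" "\<forall>v\<in>tangent_space M p. h \<bullet> v = f' v" for h
  proof -
    have "h - g \<in> tangent_space M p"
      using that gT by (simp add: T inner_diff)
    then have "(h - g) \<bullet> (h - g) = 0"
      using that gv by (simp add: inner_diff_left)
    then show ?thesis by simp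
  qed
  have "surface_grad M f p = g"
    unfolding surface_grad_def
  proof (rule the_equality)
    show "g \<in> tangent_space M p \<and> (\<forall>v\<in>tangent_space M p. g \<bullet> v = surface_deriv M f p v)"
      using gT gv by (simp add: surface_deriv_eq[OF f])
    show "h = g" if "h \<in> tangent_space M p \<and> (\<forall>v\<in>tangent_space M p. h \<bullet> v = surface_deriv M f p v)" for h
      using that by (intro unique) (simp_all add: surface_deriv_eq[OF f])
  qed
  then show "surface_grad M f p = r - (r \<bullet> m / (m \<bullet> m)) *\<^sub>R m"
    and "v \<in> tangent_space M p \<Longrightarrow> surface_grad M f p \<bullet> v = f' v"
    and "surface_grad M f p \<in> tangent_space M p"
    using gv gT by (simp_all add: g_def)
qed

text \<open>This brings derivatives within \<open>M\<close> to a form that sees only tangent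
  vectors, so that two of them can be compared on the tangent space alone.\<close>

lemma local_retraction_has_derivative:
  assumes "local_retraction M V \<rho> \<rho>'" "c \<in> M" "c \<in> V" "(f has_derivative f') (at c within M)"
  shows "(f has_derivative (\<lambda>v. f' (\<rho>' c v))) (at c within M)"
  using has_derivative_in_compose[OF local_retraction_id[OF assms(1-3)], of f f'] assms(4) by simp

section \<open>Normals of smooth convex bodies\<close>

text \<open>If \<open>n\<close> and \<open>n'\<close> differ, the direction
  \<open>u = n - n'\<close> points inward for \<open>n\<close> and outward for \<open>n'\<close>, so
  nearby points \<open>x + t u\<close> would lie both in \<open>S\<close> and outside it.\<close>

lemma is_inward_normal_unique:
  assumes "is_inward_normal S x n" "is_inward_normal S x n'"
  shows "n = n'"
proof (rule ccontr)
  assume "n \<noteq> n'"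
  define u where "u = n - n'"
  have n: "norm n = 1" "norm n' = 1" and u: "norm u > 0"
    using assms \<open>n \<noteq> n'\<close> by (auto simp: is_inward_normal_def u_def)
  have "(norm u)\<^sup>2 = 2 - 2 * (n \<bullet> n')"
    using n by (simp add: u_def power2_norm_eq_inner inner_diff inner_commute) (simp add: dot_square_norm)
  then have un: "u \<bullet> n = (norm u)\<^sup>2 / 2" "u \<bullet> n' = - (norm u)\<^sup>2 / 2"
    using n by (simp_all add: u_def inner_diff dot_square_norm inner_commute)
  \<comment> \<open>Half of the value that would make both strict inequalities fail:
    \<open>u \<bullet> n\<close> is half of the squared norm of \<open>u\<close>, while
    \<open>\<epsilon> * norm u\<close> is a quarter of it.\<close>
  define \<epsilon> where "\<epsilon> = norm u / 4"
  have "\<epsilon> > 0"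
    using u by (simp add: \<epsilon>_def)
  then have "\<forall>\<^sub>F y in nhds x. (((y - x) \<bullet> n > \<epsilon> * norm (y - x) \<longrightarrow> y \<in> S) \<and>
        ((y - x) \<bullet> n' < - \<epsilon> * norm (y - x) \<longrightarrow> y \<notin> S))"
    using assms unfolding is_inward_normal_def by (auto simp: eventually_conj_iff)
  moreover have "((\<lambda>t. x + t *\<^sub>R u) \<longlongrightarrow> x) (at_right 0)"
    by (auto intro!: tendsto_eq_intros)
  ultimately have "\<forall>\<^sub>F t in at_right 0. ((x + t *\<^sub>R u - x) \<bullet> n > \<epsilon> * norm (x + t *\<^sub>R u - x) \<longrightarrow> x + t *\<^sub>R u \<in> S) \<and>
        ((x + t *\<^sub>R u - x) \<bullet> n' < - \<epsilon> * norm (x + t *\<^sub>R u - x) \<longrightarrow> x + t *\<^sub>R u \<notin> S)"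
    by (rule eventually_compose_filterlim)
  then have "\<forall>\<^sub>F t::real in at_right 0. False"
    using eventually_at_right_less[of 0]
  proof eventually_elim
    case (elim t)
    have "t * (norm u)\<^sup>2 > 0"
      using elim u by simp
    with elim show ?case
      by (auto simp: un \<epsilon>_def power2_eq_square)
  qed
  then show False
    by simp
qed

lemma inward_normal_eq: "is_inward_normal S x n \<Longrightarrow> inward_normal S x = n"
  unfolding inward_normal_def using is_inward_normal_unique by blast

locale smooth_convex_body =
  fixes C :: "'a::euclidean_space set"
  assumes compact: "compact C" and convex: "convex C" and interior: "interior C \<noteq> {}"
    and manifold: "C2_manifold (DIM('a) - 1) (frontier C)"
begin

lemma closed: "closed C" and nonempty: "C \<noteq> {}"
  using compact interior by (auto simp: compact_imp_closed)

lemma frontier_subset: "frontier C \<subseteq> C"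
  using closed frontier_subset_closed by blast

text \<open>The retraction maps into \<open>C\<close>, so the function
  \<open>a \<bullet> \<rho> x\<close> has a maximum at \<open>c\<close> and its derivative vanishes
  there. This puts the tangent space inside the hyperplane, and dimensions force equality.\<close>

lemma tangent_space_eq:
  assumes "c \<in> frontier C" "a \<noteq> 0" "\<And>y. y \<in> C \<Longrightarrow> a \<bullet> (y - c) \<le> 0"
  shows "tangent_space (frontier C) c = {v. a \<bullet> v = 0}"
proof -
  obtain V \<rho> \<rho>' where V: "local_retraction (frontier C) V \<rho> \<rho>'" "c \<in> V"
    and dim: "DIM('a) - 1 \<le> dim (tangent_space (frontier C) c)"
    using C2_manifold_local_retraction[OF manifold assms(1)] by blast
  have \<rho>: "open V" "\<rho> c = c" "(\<rho> has_derivative \<rho>' c) (at c)" "\<And>x. x \<in> V \<Longrightarrow> \<rho> x \<in> C"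
    using V assms frontier_subset by (auto simp: local_retraction_def)
  note range = local_retraction_range[OF V(1) assms(1) V(2)]
  have "((\<lambda>x. a \<bullet> \<rho> x) has_derivative (\<lambda>v. a \<bullet> \<rho>' c v)) (at c)"
    using \<rho>(3) by (rule has_derivative_inner_right)
  then have "(\<lambda>v. a \<bullet> \<rho>' c v) = (\<lambda>v. 0)"
    by (rule differential_zero_maxmin[OF V(2) \<rho>(1)]) (use \<rho> assms(3) in \<open>auto simp: inner_diff\<close>)
  then have sub: "tangent_space (frontier C) c \<subseteq> {v. a \<bullet> v = 0}"
    unfolding range[symmetric] by (auto simp: fun_eq_iff)
  have subsp: "subspace (tangent_space (frontier C) c)"
    unfolding range[symmetric]
    by (simp add: blinfun.bounded_linear_right bounded_linear.linear linear_subspace_image)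
  show ?thesis
    by (rule subspace_dim_equal[OF subsp subspace_hyperplane sub])
      (use dim dim_hyperplane[OF assms(2)] in simp)
qed

text \<open>Both vectors are normal to the same tangent hyperplane, so they agree up to sign.
  Opposite signs would confine \<open>C\<close> to a hyperplane, contradicting its nonempty
  interior.\<close>

lemma support_unique:
  assumes "c \<in> frontier C" "norm a = 1" "\<And>y. y \<in> C \<Longrightarrow> a \<bullet> (y - c) \<le> 0"
    and "norm b = 1" "\<And>y. y \<in> C \<Longrightarrow> b \<bullet> (y - c) \<le> 0"
  shows "a = b"
proof -
  have nz: "a \<noteq> 0" "b \<noteq> 0"
    using assms by auto
  have T: "{v. a \<bullet> v = 0} = {v. b \<bullet> v = 0}"
    using tangent_space_eq[OF assms(1) nz(1) assms(3)] tangent_space_eq[OF assms(1) nz(2) assms(5)]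
    by simp
  have aa: "a \<bullet> a = 1" "b \<bullet> b = 1"
    using assms by (simp_all add: dot_square_norm)
  have "a \<bullet> (b - (a \<bullet> b) *\<^sub>R a) = 0"
    using aa by (simp add: inner_diff)
  then have "b \<bullet> (b - (a \<bullet> b) *\<^sub>R a) = 0"
    using T by blast
  then have ab: "(a \<bullet> b)\<^sup>2 = 1"
    using aa by (simp add: inner_diff power2_eq_square inner_commute)
  then consider "a \<bullet> b = 1" | "a \<bullet> b = - 1"
    by (auto simp: power2_eq_1_iff)
  then show ?thesis
  proof cases
    case 1
    then have "(a - b) \<bullet> (a - b) = 0"
      using aa by (simp add: inner_diff inner_commute)
    then show ?thesis by simp
  next
    case 2
    then have "(a + b) \<bullet> (a + b) = 0"
      using aa by (simp add: inner_add inner_commute)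
    then have "b = - a"
      by (simp add: add_eq_0_iff)
    then have "C \<subseteq> {y. a \<bullet> y = a \<bullet> c}"
      using assms(3,5) by (force simp: inner_diff)
    then have "interior C \<subseteq> {}"
      using interior_mono interior_hyperplane[OF nz(1)] by metis
    then show ?thesis
      using interior by simp
  qed
qed

lemma closest_point_frontier:
  assumes "y \<notin> C"
  shows "closest_point C y \<in> frontier C"
proof -
  have "y \<in> affine hull C - rel_interior C"
    using assms affine_hull_nonempty_interior[OF interior] rel_interior_subset by blast
  then show ?thesis
    using closest_point_in_rel_frontier[OF closed nonempty] rel_frontier_nonempty_interior[OF interior]
    by simp
qed

lemma is_inward_normal_support:
  assumes "c \<in> frontier C" "norm a = 1" "\<And>y. y \<in> C \<Longrightarrow> a \<bullet> (y - c) \<le> 0"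
  shows "is_inward_normal C c (- a)"
proof -
  \<comment> \<open>Points outside \<open>C\<close> contradicting the claim have closest-point normals that tend to a supporting
    normal at \<open>c\<close>, hence to \<open>a\<close>, while staying at distance at least \<open>\<epsilon>\<close> from it.\<close>
  have "\<forall>\<^sub>F y in nhds c. ((y - c) \<bullet> - a > \<epsilon> * norm (y - c) \<longrightarrow> y \<in> C)" if "\<epsilon> > 0" for \<epsilon>
  proof (rule ccontr)
    assume "\<not> ?thesis"
    then have "\<exists>y. dist y c < d \<and> (y - c) \<bullet> - a > \<epsilon> * norm (y - c) \<and> y \<notin> C" if "d > 0" for d
      using that unfolding eventually_nhds_metric by blast
    then have "\<exists>y. dist y c < inverse (real (Suc k)) \<and> (y - c) \<bullet> - a > \<epsilon> * norm (y - c) \<and> y \<notin> C" for k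
      by simp
    then obtain Y where Y: "\<And>k. dist (Y k) c < inverse (real (Suc k))"
      "\<And>k. (Y k - c) \<bullet> - a > \<epsilon> * norm (Y k - c)" "\<And>k. Y k \<notin> C"
      by metis
    have Y_lim: "Y \<longlonglongrightarrow> c"
    proof -
      have "(\<lambda>k. dist (Y k) c) \<longlonglongrightarrow> 0"
        by (rule tendsto_sandwich[OF _ _ tendsto_const LIMSEQ_inverse_real_of_nat])
          (use Y(1) in \<open>auto intro!: always_eventually less_imp_le\<close>)
      then show ?thesis
        using tendsto_dist_iff by blast
    qed
    define Z where "Z k = closest_point C (Y k)" for k
    define A where "A k = (Y k - Z k) /\<^sub>R norm (Y k - Z k)" for k
    have ZC: "Z k \<in> C" for k
      using closest_point_in_set[OF closed nonempty] by (simp add: Z_def)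
    then have YZ: "norm (Y k - Z k) > 0" for k
      using Y(3) by (metis eq_iff_diff_eq_0 zero_less_norm_iff)
    have A_norm: "norm (A k) = 1" for k
      using YZ[of k] by (simp add: A_def)
    have A_support: "A k \<bullet> (y - Z k) \<le> 0" if "y \<in> C" for k y
      using closest_point_dot[OF convex closed that, of "Y k"] YZ[of k]
      by (auto simp: A_def Z_def mult_le_0_iff)
    have "isCont (closest_point C) c"
      using continuous_at_closest_point[OF convex closed nonempty] .
    then have Z_lim: "Z \<longlonglongrightarrow> c"
      using isCont_tendsto_compose[OF _ Y_lim] closest_point_self[of c C] frontier_subset assms(1)
      unfolding Z_def[abs_def] by (metis subsetD)
    have "compact (sphere (0::'a) 1)"
      by simp
    then obtain b r where b: "b \<in> sphere 0 1" "strict_mono r" "(A \<circ> r) \<longlonglongrightarrow> b"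
      using A_norm unfolding compact_def by (metis mem_sphere_0)
    have Zr: "(Z \<circ> r) \<longlonglongrightarrow> c"
      using LIMSEQ_subseq_LIMSEQ[OF Z_lim b(2)] .
    have "b \<bullet> (y - c) \<le> 0" if "y \<in> C" for y
    proof (rule LIMSEQ_le_const2)
      show "(\<lambda>k. (A \<circ> r) k \<bullet> (y - (Z \<circ> r) k)) \<longlonglongrightarrow> b \<bullet> (y - c)"
        by (intro tendsto_intros b Zr)
    qed (use A_support that in auto)
    then have "b = a"
      using support_unique[OF assms(1) _ _ assms(2,3)] b(1) by simp
    \<comment> \<open>The normal \<open>?a\<close> has positive inner product with
      \<open>?y - c\<close>, whereas that of \<open>a\<close> is below
      \<open>- \<epsilon> * norm (?y - c)\<close>. Cauchy-Schwarz applied to \<open>?a - a\<close>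
      gives the bound.\<close>
    have "norm ((A \<circ> r) k - a) \<ge> \<epsilon>" for k
    proof -
      let ?y = "Y (r k)" and ?z = "Z (r k)" and ?a = "A (r k)"
      have "?a \<bullet> (?y - ?z) = norm (?y - ?z)"
        using YZ[of "r k"] by (simp add: A_def dot_square_norm power2_eq_square)
      moreover have "?a \<bullet> (c - ?z) \<le> 0"
        using A_support frontier_subset assms(1) by blast
      ultimately have "?a \<bullet> (?y - c) > 0"
        using YZ[of "r k"] unfolding inner_diff_right by linarith
      then have "\<epsilon> * norm (?y - c) < (?a - a) \<bullet> (?y - c)"
        using Y(2)[of "r k"] by (simp add: inner_diff inner_commute)
      also have "\<dots> \<le> norm (?a - a) * norm (?y - c)"
        by (rule norm_cauchy_schwarz)
      finally show ?thesis
        by (simp add: mult_less_cancel_right)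
    qed
    moreover have "(\<lambda>k. norm ((A \<circ> r) k - a)) \<longlonglongrightarrow> norm (b - a)"
      by (intro tendsto_intros b)
    ultimately have "norm (b - a) \<ge> \<epsilon>"
      by (intro LIMSEQ_le_const) auto
    then show False
      using \<open>b = a\<close> that by simp
  qed
  moreover have "y \<notin> C" if "\<epsilon> > 0" "(y - c) \<bullet> - a < - \<epsilon> * norm (y - c)" for \<epsilon> y
  proof
    assume "y \<in> C"
    then have "(y - c) \<bullet> - a \<ge> 0"
      using assms(3)[of y] by (simp add: inner_commute)
    moreover have "\<epsilon> * norm (y - c) \<ge> 0"
      using that by simp
    ultimately show False
      using that by linarith
  qed
  ultimately show ?thesis
    using assms(1,2) by (auto simp: is_inward_normal_def elim: eventually_mono)
qed

text \<open>A supporting hyperplane exists at \<open>c\<close> by convexity. Its unit normal is the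
  outward normal by \<open>is_inward_normal_support\<close>.\<close>

lemma
  assumes "c \<in> frontier C"
  shows norm_outward_normal: "norm (outward_normal C c) = 1"
    and outward_normal_support: "\<And>y. y \<in> C \<Longrightarrow> outward_normal C c \<bullet> (y - c) \<le> 0"
proof -
  have "c \<in> C" "c \<notin> rel_interior C"
    using assms frontier_subset rel_interior_nonempty_interior[OF interior]
    unfolding frontier_def by blast+
  then obtain a where a: "a \<noteq> 0" "\<And>y. y \<in> C \<Longrightarrow> a \<bullet> c \<le> a \<bullet> y"
    using supporting_hyperplane_relative_frontier[OF convex, of c] closed by (metis closure_closed)
  define n where "n = - (a /\<^sub>R norm a)"
  have n: "norm n = 1" "\<And>y. y \<in> C \<Longrightarrow> n \<bullet> (y - c) \<le> 0"
    using a by (simp_all add: n_def inner_diff_right mult_left_mono)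
  have "outward_normal C c = n"
    using inward_normal_eq[OF is_inward_normal_support[OF assms n]] by (simp add: outward_normal_def)
  with n show "norm (outward_normal C c) = 1"
    "\<And>y. y \<in> C \<Longrightarrow> outward_normal C c \<bullet> (y - c) \<le> 0"
    by simp_all
qed

lemma tangent_space_frontier:
  assumes "c \<in> frontier C"
  shows "tangent_space (frontier C) c = {v. outward_normal C c \<bullet> v = 0}"
  using tangent_space_eq[OF assms _ outward_normal_support[OF assms]] norm_outward_normal[OF assms]
  by force

text \<open>By the supporting inequality, every point of \<open>C\<close> is at distance at least
  \<open>r\<close> from \<open>c + r n\<close>, where \<open>n\<close> is the outward normal at
  \<open>c\<close>, already when measured along \<open>n\<close>.\<close>

lemma closest_point_normal_ray:
  assumes "c \<in> frontier C" "r \<ge> 0"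
  shows "closest_point C (c + r *\<^sub>R outward_normal C c) = c"
proof -
  let ?n = "outward_normal C c"
  have "dist (c + r *\<^sub>R ?n) c \<le> dist (c + r *\<^sub>R ?n) y" if "y \<in> C" for y
  proof -
    have "r \<le> ?n \<bullet> (c + r *\<^sub>R ?n - y)"
      using outward_normal_support[OF assms(1) that] norm_outward_normal[OF assms(1)]
      by (simp add: inner_diff inner_add dot_square_norm)
    also have "\<dots> \<le> norm (c + r *\<^sub>R ?n - y)"
      using norm_cauchy_schwarz[of ?n "c + r *\<^sub>R ?n - y"] norm_outward_normal[OF assms(1)] by simp
    finally show ?thesis
      using assms norm_outward_normal[OF assms(1)] by (simp add: dist_norm)
  qed
  then show ?thesis
    using closest_point_unique[OF convex closed] assms(1) frontier_subset by (metis subsetD)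
qed

text \<open>The variational inequality for the closest point makes the normalized displacement a
  supporting unit vector, and such a vector is unique.\<close>

lemma closest_point_decomposition:
  assumes "y \<notin> C"
  shows "y = closest_point C y + norm (y - closest_point C y) *\<^sub>R outward_normal C (closest_point C y)"
proof -
  let ?c = "closest_point C y"
  have c: "?c \<in> frontier C"
    using closest_point_frontier[OF assms] .
  have ny: "norm (y - ?c) > 0"
    using c frontier_subset assms by (metis eq_iff_diff_eq_0 subsetD zero_less_norm_iff)
  have eq: "(y - ?c) /\<^sub>R norm (y - ?c) = outward_normal C ?c"
  proof (rule support_unique[OF c _ _ norm_outward_normal[OF c] outward_normal_support[OF c]])
    show "norm ((y - ?c) /\<^sub>R norm (y - ?c)) = 1"
      using ny by simp
    show "((y - ?c) /\<^sub>R norm (y - ?c)) \<bullet> (z - ?c) \<le> 0" if "z \<in> C" for z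
      using closest_point_dot[OF convex closed that, of y] ny by (auto simp: mult_le_0_iff)
  qed
  have "norm (y - ?c) *\<^sub>R outward_normal C ?c = y - ?c"
    using ny unfolding eq[symmetric] by simp
  then show ?thesis
    by simp
qed

end

section \<open>Differentiability of the tangential gradient\<close>

context smooth_convex_body
begin

lemma subspace_tangent_space: "c \<in> frontier C \<Longrightarrow> subspace (tangent_space (frontier C) c)"
  by (simp add: tangent_space_frontier subspace_hyperplane)

lemma surface_grad_tangent:
  assumes "c \<in> frontier C" "(f has_derivative f') (at c within frontier C)"
  shows "surface_grad (frontier C) f c \<in> tangent_space (frontier C) c"
    and "v \<in> tangent_space (frontier C) c \<Longrightarrow> surface_grad (frontier C) f c \<bullet> v = f' v"
  using surface_grad_hyperplane[OF tangent_space_frontier[OF assms(1)] _ assms(2)]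
    norm_outward_normal[OF assms(1)] by force+

text \<open>The explicit formula for the gradient requires a normal field that is differentiable at
  \<open>p\<close>. Instead of the unit normal, whose regularity would have to be proved, a field
  \<open>m\<close> is built from the derivative of the retraction.\<close>

lemma surface_grad_differentiable:
  assumes f: "C2_on (frontier C) f" and p: "p \<in> frontier C"
  shows "surface_grad (frontier C) f differentiable (at p within frontier C)"
proof -
  let ?M = "frontier C"
  obtain V \<rho> \<rho>' where V: "local_retraction ?M V \<rho> \<rho>'" "p \<in> V"
    using C2_manifold_local_retraction[OF manifold p] by blast
  obtain U f' where U: "open U" "p \<in> U" and f': "f' differentiable at p"
    "\<forall>x\<in>?M \<inter> U. (f has_derivative blinfun_apply (f' x)) (at x within ?M)"
    using C2_on_has_derivative[OF f p] by blast
  define n where "n = outward_normal C p"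
  have n: "norm n = 1" "tangent_space ?M p = {v. n \<bullet> v = 0}"
    using norm_outward_normal[OF p] tangent_space_frontier[OF p] by (auto simp: n_def)
  \<comment> \<open>the gradient at \<open>x\<close> of the function \<open>y \<mapsto> n \<bullet> (y - \<rho> y)\<close>, which vanishes on the frontier\<close>
  define m where "m x = n - (\<Sum>b\<in>Basis. (n \<bullet> \<rho>' x b) *\<^sub>R b)" for x
  define r where "r x = (\<Sum>b\<in>Basis. f' x b *\<^sub>R b)" for x
  have m_inner: "m x \<bullet> v = n \<bullet> v - n \<bullet> \<rho>' x v" for x v
  proof -
    have "\<rho>' x v = \<rho>' x (\<Sum>b\<in>Basis. (v \<bullet> b) *\<^sub>R b)"
      by (simp add: euclidean_representation)
    also have "\<dots> = (\<Sum>b\<in>Basis. (v \<bullet> b) *\<^sub>R \<rho>' x b)"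
      by (simp add: blinfun.bilinear_simps blinfun.sum_right)
    finally show ?thesis
      by (simp add: m_def inner_diff_left inner_diff_right inner_sum_left inner_sum_right inner_commute mult.commute)
  qed
  have "\<rho>' p v \<in> tangent_space ?M p" for v
    using local_retraction_range[OF V(1) p V(2)] by blast
  then have "m p \<bullet> v = n \<bullet> v" for v
    using n(2) unfolding m_inner by force
  then have mp: "m p = n"
    using vector_eq_ldot[of "m p" n] by (simp add: inner_commute)
  obtain D\<rho> where "(\<rho>' has_derivative D\<rho>) (at p)"
    using V by (auto simp: local_retraction_def differentiable_def)
  then have \<rho>'_apply: "((\<lambda>x. \<rho>' x b) has_derivative (\<lambda>h. D\<rho> h b)) (at p within ?M)" for b
    by (rule bounded_linear.has_derivative[OF blinfun.bounded_linear_left has_derivative_at_withinI])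
  obtain Df where "(f' has_derivative Df) (at p)"
    using f'(1) by (auto simp: differentiable_def)
  then have f'_apply: "((\<lambda>x. f' x b) has_derivative (\<lambda>h. Df h b)) (at p within ?M)" for b
    by (rule bounded_linear.has_derivative[OF blinfun.bounded_linear_left has_derivative_at_withinI])
  have "\<exists>Dm. (m has_derivative Dm) (at p within ?M)"
    unfolding m_def[abs_def] by (rule exI) (rule has_derivative_diff has_derivative_const has_derivative_sum
        has_derivative_scaleR_left has_derivative_inner_right \<rho>'_apply)+
  then obtain Dm where Dm: "(m has_derivative Dm) (at p within ?M)" ..
  have "\<exists>Dr. (r has_derivative Dr) (at p within ?M)"
    unfolding r_def[abs_def] by (rule exI) (rule has_derivative_sum has_derivative_scaleR_left f'_apply)+
  then obtain Dr where Dr: "(r has_derivative Dr) (at p within ?M)" ..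
  have mm: "m p \<bullet> m p \<noteq> 0"
    using mp n(1) by auto
  have "\<exists>Dg. ((\<lambda>x. r x - (r x \<bullet> m x / (m x \<bullet> m x)) *\<^sub>R m x) has_derivative Dg) (at p within ?M)"
    by (rule exI) (rule has_derivative_diff has_derivative_scaleR has_derivative_divide'
        has_derivative_inner Dm Dr mm)+
  then obtain Dg where Dg: "((\<lambda>x. r x - (r x \<bullet> m x / (m x \<bullet> m x)) *\<^sub>R m x) has_derivative Dg) (at p within ?M)" ..
  have eq: "r x - (r x \<bullet> m x / (m x \<bullet> m x)) *\<^sub>R m x = surface_grad ?M f x"
    if x: "x \<in> ?M" "x \<in> V" "x \<in> U" "m x \<noteq> 0" for x
  proof -
    \<comment> \<open>Since \<open>\<rho>' x\<close> fixes tangent vectors, the two terms of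
      \<open>m_inner\<close> cancel on them.\<close>
    have "tangent_space ?M x \<subseteq> {v. m x \<bullet> v = 0}"
      using local_retraction_fixes[OF V(1) x(1,2)] by (auto simp: m_inner)
    moreover have "dim {v. m x \<bullet> v = 0} \<le> dim (tangent_space ?M x)"
      using tangent_space_frontier[OF x(1)] norm_outward_normal[OF x(1)] x(4)
      by (metis dim_hyperplane norm_zero order_refl zero_neq_one)
    ultimately have "tangent_space ?M x = {v. m x \<bullet> v = 0}"
      by (intro subspace_dim_equal subspace_tangent_space x subspace_hyperplane)
    then show ?thesis
      using surface_grad_hyperplane(1)[OF _ x(4) bspec[OF f'(2)]] x by (simp add: r_def)
  qed
  have "(m \<longlongrightarrow> n) (at p within ?M)"
    using has_derivative_continuous[OF Dm] mp by (simp add: continuous_within)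
  then have "\<forall>\<^sub>F x in at p within ?M. m x \<noteq> 0"
    using n(1) by (intro tendsto_imp_eventually_ne) auto
  moreover have "\<forall>\<^sub>F x in at p within ?M. x \<in> V \<inter> U \<and> x \<in> ?M"
    using V U unfolding eventually_at_topological local_retraction_def by (intro exI[of _ "V \<inter> U"]) auto
  ultimately have "\<forall>\<^sub>F x in at p within ?M. r x - (r x \<bullet> m x / (m x \<bullet> m x)) *\<^sub>R m x = surface_grad ?M f x"
    by eventually_elim (use eq in auto)
  then have "(surface_grad ?M f has_derivative Dg) (at p within ?M)"
    by (rule has_derivative_transform_eventually[OF Dg]) (use eq[OF p V(2) U(2)] mm p in auto)
  then show ?thesis
    by (auto simp: differentiable_def)
qed

end

section \<open>Critical points of the thickness are fixed points\<close>

locale radial_domain = smooth_convex_body C for C :: "'a::euclidean_space set" +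
  fixes \<Omega> :: "'a set"
  assumes open_domain: "open \<Omega>" and bounded_domain: "bounded \<Omega>" and subset_domain: "C \<subseteq> \<Omega>"
    and radial_bij: "bij_betw (radial_map C \<Omega>) (frontier C) (frontier \<Omega> - C)"
begin

text \<open>Boundedness of \<open>\<Omega>\<close> makes the supremum meaningful, and openness makes
  the inequality strict, since the ray stays in \<open>\<Omega>\<close> slightly beyond
  \<open>r\<close>.\<close>

lemma thickness_greater:
  assumes "c \<in> frontier C" "r \<ge> 0" "c + r *\<^sub>R outward_normal C c \<in> \<Omega>"
  shows "r < thickness C \<Omega> c"
proof -
  let ?n = "outward_normal C c"
  have n: "norm ?n = 1"
    using norm_outward_normal[OF assms(1)] .
  obtain B where B: "\<And>x. x \<in> \<Omega> \<Longrightarrow> norm x \<le> B"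
    using bounded_domain by (auto simp: bounded_iff)
  have bdd: "bdd_above {r. r \<ge> 0 \<and> c + r *\<^sub>R ?n \<in> \<Omega>}"
  proof (rule bdd_aboveI)
    fix s assume "s \<in> {r. r \<ge> 0 \<and> c + r *\<^sub>R ?n \<in> \<Omega>}"
    then have "s = norm (s *\<^sub>R ?n)" "norm (c + s *\<^sub>R ?n) \<le> B"
      using n B by auto
    then show "s \<le> B + norm c"
      using norm_triangle_ineq2[of "s *\<^sub>R ?n" "- c"] by (simp add: add.commute)
  qed
  obtain e where e: "e > 0" "ball (c + r *\<^sub>R ?n) e \<subseteq> \<Omega>"
    using open_domain assms(3) openE by blast
  have "c + (r + e / 2) *\<^sub>R ?n \<in> ball (c + r *\<^sub>R ?n) e"
    using n e(1) by (simp add: dist_norm scaleR_add_left)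
  then have "r + e / 2 \<le> thickness C \<Omega> c"
    unfolding thickness_def using e assms(2) by (intro cSup_upper bdd) auto
  then show ?thesis
    using e by simp
qed

lemma thickness_pos: "c \<in> frontier C \<Longrightarrow> thickness C \<Omega> c > 0"
  using thickness_greater[of c 0] frontier_subset subset_domain by auto

text \<open>If \<open>y\<close> lay outside \<open>\<Omega>\<close> at a distance below the
  thickness, the segment from its closest point \<open>c\<close> to \<open>y\<close> would meet the
  boundary of \<open>\<Omega>\<close>. By the parametrization, that happens on the normal ray at
  \<open>c\<close> only at distance \<open>thickness C \<Omega> c\<close>. The converse is
  \<open>thickness_greater\<close>.\<close>

lemma mem_domain_iff:
  assumes "y \<notin> C"
  shows "y \<in> \<Omega> \<longleftrightarrow> norm (y - closest_point C y) < thickness C \<Omega> (closest_point C y)"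
proof -
  define c where "c = closest_point C y"
  define r where "r = norm (y - c)"
  let ?n = "outward_normal C c"
  have c: "c \<in> frontier C"
    using closest_point_frontier[OF assms] by (simp add: c_def)
  have y: "y = c + r *\<^sub>R ?n"
    using closest_point_decomposition[OF assms] by (simp add: c_def r_def)
  have "y \<in> \<Omega>" if "r < thickness C \<Omega> c"
  proof (rule ccontr)
    assume "y \<notin> \<Omega>"
    moreover have "c \<in> \<Omega>"
      using c frontier_subset subset_domain by auto
    ultimately have "closed_segment c y \<inter> frontier \<Omega> \<noteq> {}"
      by (intro connected_Int_frontier) auto
    then obtain u where u: "0 \<le> u" "u \<le> 1" "(1 - u) *\<^sub>R c + u *\<^sub>R y \<in> frontier \<Omega>"
      unfolding closed_segment_def by blast
    define s where "s = u * r"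
    have s: "0 \<le> s" "s \<le> r" "c + s *\<^sub>R ?n \<in> frontier \<Omega>"
    proof -
      have "(1 - u) *\<^sub>R c + u *\<^sub>R y = c + s *\<^sub>R ?n"
        by (subst y) (simp add: s_def algebra_simps)
      with u show "0 \<le> s" "s \<le> r" "c + s *\<^sub>R ?n \<in> frontier \<Omega>"
        by (auto simp: s_def r_def mult_left_le_one_le)
    qed
    moreover have "frontier \<Omega> \<inter> C = {}"
      using open_domain subset_domain by (auto simp: frontier_def interior_open)
    ultimately have "c + s *\<^sub>R ?n \<in> radial_map C \<Omega> ` frontier C"
      using radial_bij by (auto simp: bij_betw_def)
    then obtain c' where c': "c' \<in> frontier C"
      "c + s *\<^sub>R ?n = c' + thickness C \<Omega> c' *\<^sub>R outward_normal C c'"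
      by (auto simp: radial_map_def)
    \<comment> \<open>Both are the closest point of \<open>C\<close> to one and the same boundary
      point of \<open>\<Omega>\<close>.\<close>
    have "c = c'"
      using closest_point_normal_ray[OF c s(1)] closest_point_normal_ray[OF c'(1), of "thickness C \<Omega> c'"]
        c'(2) thickness_pos[OF c'(1)] by simp
    then have "(s - thickness C \<Omega> c) *\<^sub>R ?n = 0"
      using c'(2) by (simp add: scaleR_diff_left)
    then have "s = thickness C \<Omega> c"
      using norm_outward_normal[OF c] by auto
    then show False
      using that s by simp
  qed
  then show ?thesis
    using thickness_greater[OF c, of r, folded y] unfolding c_def r_def by (meson norm_ge_zero)
qed

lemma radial_map_frontier:
  assumes "c \<in> frontier C"
  shows "radial_map C \<Omega> c \<in> frontier \<Omega>" "radial_map C \<Omega> c \<notin> C"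
  using bij_betwE[OF radial_bij] assms by auto

text \<open>With \<open>h\<close> the height of \<open>y\<close> over \<open>x\<close> along
  \<open>n\<close> and \<open>s\<close> the distance from \<open>x\<close>, the distance from
  \<open>y\<close> to \<open>C\<close> is \<open>D + h\<close> up to an error quadratic in
  \<open>s\<close>. The thickness at the closest point is \<open>D\<close> up to
  \<open>\<epsilon> / 2 * s\<close>. Hence the sign of \<open>h\<close> decides membership in
  \<open>\<Omega>\<close> as soon as its modulus exceeds \<open>\<epsilon> * s\<close>.\<close>

lemma is_inward_normal_critical:
  assumes c: "c \<in> frontier C" and d: "(thickness C \<Omega> has_derivative (\<lambda>v. 0)) (at c within frontier C)"
  shows "is_inward_normal \<Omega> (radial_map C \<Omega> c) (- outward_normal C c)"
proof -
  define n where "n = outward_normal C c"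
  define D where "D = thickness C \<Omega> c"
  define x where "x = radial_map C \<Omega> c"
  let ?P = "closest_point C"
  have n: "norm n = 1" "n \<bullet> n = 1" and D: "D > 0" and x: "x = c + D *\<^sub>R n"
    using norm_outward_normal[OF c] thickness_pos[OF c]
    by (auto simp: n_def D_def x_def radial_map_def dot_square_norm)
  have Px: "?P x = c"
    using closest_point_normal_ray[OF c] D x by (simp add: n_def)
  have "\<forall>\<^sub>F y in nhds x.
        ((y - x) \<bullet> - n > \<epsilon> * norm (y - x) \<longrightarrow> y \<in> \<Omega>) \<and>
        ((y - x) \<bullet> - n < - \<epsilon> * norm (y - x) \<longrightarrow> y \<notin> \<Omega>)" if "\<epsilon> > 0" for \<epsilon>
  proof -
    obtain \<delta> where \<delta>: "\<delta> > 0" "\<And>z. z \<in> frontier C \<Longrightarrow> norm (z - c) < \<delta> \<Longrightarrow>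
        \<bar>thickness C \<Omega> z - D\<bar> \<le> \<epsilon> / 2 * norm (z - c)"
      using d[unfolded has_derivative_within_alt, THEN conjunct2, rule_format, of "\<epsilon> / 2"] \<open>\<epsilon> > 0\<close>
      by (auto simp: D_def)
    \<comment> \<open>The radius \<open>\<delta>\<close> is for the thickness estimate; the radius
      \<open>\<epsilon> * D\<close> makes the quadratic error \<open>s\<^sup>2 / (2 * D)\<close>
      smaller than \<open>\<epsilon> / 2 * s\<close>.\<close>
    have "open (- C \<inter> ball x (min \<delta> (\<epsilon> * D)))" "x \<in> - C \<inter> ball x (min \<delta> (\<epsilon> * D))"
      using closed radial_map_frontier(2)[OF c] \<delta> that D by (auto simp: x_def)
    then have "\<forall>\<^sub>F y in nhds x. y \<in> - C \<inter> ball x (min \<delta> (\<epsilon> * D))"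
      by (rule eventually_nhds_in_open)
    then show ?thesis
    proof eventually_elim
      case (elim y)
      define s where "s = norm (y - x)"
      define h where "h = (y - x) \<bullet> n"
      have y: "y \<notin> C" "s < \<delta>" "s < \<epsilon> * D"
        using elim by (auto simp: s_def dist_norm norm_minus_commute)
      have Py: "?P y \<in> frontier C"
        using closest_point_frontier[OF y(1)] .
      \<comment> \<open>The closest-point map is 1-Lipschitz and sends \<open>x\<close> to
        \<open>c\<close>.\<close>
      have Pyc: "norm (?P y - c) \<le> s"
        using closest_point_lipschitz[OF convex closed nonempty, of y x] Px by (simp add: dist_norm s_def)
      have "\<bar>thickness C \<Omega> (?P y) - D\<bar> \<le> \<epsilon> / 2 * norm (?P y - c)"
        using \<delta>(2)[OF Py] Pyc y by simp
      also have "\<dots> \<le> \<epsilon> / 2 * s"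
        using Pyc that by (intro mult_left_mono) auto
      finally have th: "\<bar>thickness C \<Omega> (?P y) - D\<bar> \<le> \<epsilon> / 2 * s" .
      have lower: "norm (y - ?P y) \<ge> D + h"
      proof -
        have "n \<bullet> (?P y - c) \<le> 0"
          using outward_normal_support[OF c] closest_point_in_set[OF closed nonempty] by (simp add: n_def)
        then have "D + h \<le> n \<bullet> (y - ?P y)"
          using n by (simp add: h_def x inner_diff inner_add inner_commute)
        also have "\<dots> \<le> norm (y - ?P y)"
          using norm_cauchy_schwarz[of n "y - ?P y"] n by simp
        finally show ?thesis .
      qed
      have upper: "norm (y - ?P y) \<le> D + h + s\<^sup>2 / (2 * D)"
      proof -
        have "norm (y - ?P y) \<le> norm (y - c)"
          using closest_point_le[OF closed, of c y] c frontier_subset by (auto simp: dist_norm)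
        moreover have "(norm (y - c))\<^sup>2 = D\<^sup>2 + 2 * D * h + s\<^sup>2"
        proof -
          have "y - c = D *\<^sub>R n + (y - x)"
            by (simp add: x)
          then have "(norm (y - c))\<^sup>2 = (D *\<^sub>R n + (y - x)) \<bullet> (D *\<^sub>R n + (y - x))"
            by (simp only: power2_norm_eq_inner)
          also have "\<dots> = D * D * (n \<bullet> n) + 2 * D * ((y - x) \<bullet> n) + (y - x) \<bullet> (y - x)"
            by (simp only: inner_add_left inner_add_right inner_scaleR_left inner_scaleR_right
                inner_commute[of n "y - x"]) (simp add: algebra_simps)
          finally show ?thesis
            using n by (simp add: s_def h_def power2_norm_eq_inner power2_eq_square[of D])
        qed
        \<comment> \<open>The arithmetic-geometric mean inequality replaces the expansion of a
          square root.\<close>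
        moreover have "2 * D * norm (y - c) \<le> D\<^sup>2 + (norm (y - c))\<^sup>2"
          using sum_squares_bound[of D "norm (y - c)"] .
        ultimately have "2 * D * norm (y - ?P y) \<le> 2 * D\<^sup>2 + 2 * D * h + s\<^sup>2"
          using mult_left_mono[of "norm (y - ?P y)" "norm (y - c)" "2 * D"] D by linarith
        also have "\<dots> = 2 * D * (D + h + s\<^sup>2 / (2 * D))"
          using D by (simp add: field_simps power2_eq_square)
        finally show ?thesis
          using D by simp
      qed
      have "y \<in> \<Omega>" if "h < - \<epsilon> * s"
      proof -
        have "\<bar>h\<bar> \<le> s"
          using Cauchy_Schwarz_ineq2[of "y - x" n] n by (simp add: h_def s_def)
        then have "s > 0"
          using that \<open>\<epsilon> > 0\<close> by (cases "s = 0") (auto simp: s_def)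
        then have "s\<^sup>2 / (2 * D) < \<epsilon> / 2 * s"
          using y D by (simp add: field_simps power2_eq_square)
        then have "norm (y - ?P y) < thickness C \<Omega> (?P y)"
          using upper th that by linarith
        then show ?thesis
          using mem_domain_iff[OF y(1)] by simp
      qed
      moreover have "y \<notin> \<Omega>" if "h > \<epsilon> * s"
      proof -
        have "\<epsilon> * s \<ge> 0"
          using \<open>\<epsilon> > 0\<close> by (simp add: s_def)
        then have "\<not> norm (y - ?P y) < thickness C \<Omega> (?P y)"
          using lower th that by linarith
        then show ?thesis
          using mem_domain_iff[OF y(1)] by simp
      qed
      ultimately show ?case
        by (simp add: h_def s_def)
    qed
  qed
  then show ?thesis
    using radial_map_frontier[OF c] n by (simp add: is_inward_normal_def x_def n_def)
qed

text \<open>The inward ray from \<open>\<Phi>(c)\<close> retraces the outward normal ray at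
  \<open>c\<close>. The supporting half-space at \<open>c\<close> keeps it out of \<open>C\<close>
  before it reaches \<open>c\<close>, at parameter \<open>D\<close>.\<close>

lemma return_map_critical:
  assumes c: "c \<in> frontier C" and d: "(thickness C \<Omega> has_derivative (\<lambda>v. 0)) (at c within frontier C)"
  shows "return_map C \<Omega> c = c"
proof -
  define n where "n = outward_normal C c"
  define D where "D = thickness C \<Omega> c"
  have n: "n \<bullet> n = 1" and D: "D > 0"
    using norm_outward_normal[OF c] thickness_pos[OF c] by (auto simp: n_def D_def dot_square_norm)
  have normal: "inward_normal \<Omega> (c + D *\<^sub>R n) = - n"
    using inward_normal_eq[OF is_inward_normal_critical[OF assms]]
    by (simp add: n_def D_def radial_map_def)
  have "D \<le> t" if "c + D *\<^sub>R n + t *\<^sub>R (- n) \<in> C" for t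
  proof -
    have "n \<bullet> (c + D *\<^sub>R n + t *\<^sub>R (- n) - c) \<le> 0"
      using outward_normal_support[OF c that] by (simp add: n_def)
    then show ?thesis
      using n by (simp add: inner_diff)
  qed
  then have "Inf {t. t \<ge> 0 \<and> c + D *\<^sub>R n + t *\<^sub>R (- n) \<in> C} = D"
    using D c frontier_subset by (intro cInf_eq_minimum) auto
  then show ?thesis
    using normal
    by (simp add: return_map_def reciprocal_map_def radial_map_def n_def[symmetric] D_def[symmetric])
qed

end

section \<open>Expansion of the return map\<close>

theorem proposition7p5:
  fixes C \<Omega> U :: "'a::euclidean_space set" and c\<^sub>0 :: 'a and \<phi> :: "'a \<Rightarrow> 'a"
  assumes "compact C" and "convex C" and "interior C \<noteq> {}"
    and "C2_manifold (DIM('a) - 1) (frontier C)"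
    and "open \<Omega>" and "connected \<Omega>" and "bounded \<Omega>" and "C \<subseteq> \<Omega>"
    and "class_O C \<Omega>"
    and "C2_on (frontier C) (thickness C \<Omega>)"
    and "bij_betw (radial_map C \<Omega>) (frontier C) (frontier \<Omega> - C)"
    and "return_map C \<Omega> ` frontier C \<subseteq> frontier C"
    and "C1_on (frontier C) (return_map C \<Omega>)"
    and "nondegenerate_critical_point (frontier C) (thickness C \<Omega>) c\<^sub>0"
    and "local_coordinates (frontier C) c\<^sub>0 U \<phi>"
  shows "\<exists>R V. open V \<and> c\<^sub>0 \<in> V \<and> V \<subseteq> U \<and>
    (\<forall>c\<in>frontier C \<inter> V.
       return_map C \<Omega> c \<in> U \<and>
       R c \<in> tangent_space (frontier C) c\<^sub>0 \<and>
       \<phi> (return_map C \<Omega> c) =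
         \<phi> c
         - return_operator C \<Omega> c\<^sub>0
             (surface_deriv (frontier C) \<phi> c (surface_grad (frontier C) (thickness C \<Omega>) c))
         + R c) \<and>
    (\<lambda>c. norm (R c)) \<in> o[at c\<^sub>0 within frontier C](\<lambda>c. norm (\<phi> c))"
proof -
  interpret radial_domain C \<Omega>
    using assms by unfold_locales
  define M where "M = frontier C"
  define d where "d = thickness C \<Omega>"
  define F where "F = return_map C \<Omega>"
  define T where "T = tangent_space M c\<^sub>0"
  define grad where "grad = surface_grad M d"
  have c0: "c\<^sub>0 \<in> M" and grad0: "grad c\<^sub>0 = 0" and Hess_bij: "bij_betw (surface_hess M d c\<^sub>0) T T"
    using assms(14) by (auto simp: nondegenerate_critical_point_def M_def d_def T_def grad_def)
  have T: "subspace T"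
    using subspace_tangent_space c0 by (simp add: T_def M_def)
  obtain V \<rho> \<rho>' where V: "local_retraction M V \<rho> \<rho>'" "c\<^sub>0 \<in> V"
    using C2_manifold_local_retraction[OF manifold] c0 unfolding M_def by blast
  define L where "L = \<rho>' c\<^sub>0"
  have L_T: "L v \<in> T" for v
    using local_retraction_range[OF V(1) c0 V(2)] unfolding T_def L_def by blast
  have L_id: "((\<lambda>x. x) has_derivative L) (at c\<^sub>0 within M)"
    using local_retraction_id[OF V(1) c0 V(2)] by (simp add: L_def)
  note via_L = local_retraction_has_derivative[OF V(1) c0 V(2), folded L_def]

  \<comment> \<open>The critical point is fixed by the return map\<close>
  obtain U1 d' where U1: "open U1" "c\<^sub>0 \<in> U1"
    and "d' differentiable at c\<^sub>0" and d'_ball: "\<forall>x\<in>M \<inter> U1. (d has_derivative blinfun_apply (d' x)) (at x within M)"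
    using C2_on_has_derivative[OF assms(10)[folded M_def d_def] c0] by blast
  note d' = bspec[OF d'_ball]
  have grad_T: "grad c \<in> tangent_space M c" if "c \<in> M \<inter> U1" for c
    using surface_grad_tangent(1) d'[OF that] that by (auto simp: grad_def M_def)
  have "d' c\<^sub>0 (L v) = 0" for v
    using surface_grad_tangent(2)[of c\<^sub>0 d "d' c\<^sub>0" "L v"] d' c0 U1 L_T grad0
    by (simp add: grad_def M_def T_def)
  then have "(d has_derivative (\<lambda>v. 0)) (at c\<^sub>0 within M)"
    using via_L[OF d'[of c\<^sub>0]] c0 U1 by simp
  then have F0: "F c\<^sub>0 = c\<^sub>0"
    using return_map_critical c0 by (simp add: M_def d_def F_def)

  have F_M: "F ` M \<subseteq> M"
    using assms(12) by (simp add: F_def M_def)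
  define E where "E = surface_deriv M F c\<^sub>0"
  have E: "(F has_derivative E) (at c\<^sub>0 within M)"
    unfolding E_def by (rule surface_deriv_works C1_on_differentiable assms(13)[folded M_def F_def] c0)+
  have E_T: "E v \<in> T" if "v \<in> T" for v
    using has_derivative_into_tangent_space[OF E _ F_M] that F0 by (simp add: T_def)

  \<comment> \<open>The Hessian as derivative of the gradient, and its inverse\<close>
  define D where "D = surface_deriv M grad c\<^sub>0"
  have D: "(grad has_derivative D) (at c\<^sub>0 within M)"
    unfolding D_def using surface_grad_differentiable[OF assms(10) c0[unfolded M_def]]
    by (intro surface_deriv_works) (simp add: M_def d_def grad_def)
  have "\<rho>' differentiable at c\<^sub>0"
    using V by (simp add: local_retraction_def)
  then obtain D\<rho> where D\<rho>: "(\<rho>' has_derivative D\<rho>) (at c\<^sub>0 within M)"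
    using differentiable_at_withinI[of \<rho>' c\<^sub>0 M] unfolding differentiable_def by blast
  \<comment> \<open>Near \<open>c\<^sub>0\<close> the function \<open>\<rho>' c (grad c)\<close> is
    the gradient itself. The product rule term containing the derivative of \<open>\<rho>'\<close>
    is applied to \<open>grad c\<^sub>0 = 0\<close> and drops out, so \<open>D\<close> takes
    tangential values on \<open>T\<close>.\<close>
  have "((\<lambda>c. \<rho>' c (grad c)) has_derivative (\<lambda>h. L (D h))) (at c\<^sub>0 within M)"
    using blinfun.FDERIV[OF D\<rho> D] grad0 by (simp add: L_def)
  moreover have "open (V \<inter> U1)"
    using V U1 by (auto simp: local_retraction_def)
  ultimately have "(grad has_derivative (\<lambda>h. L (D h))) (at c\<^sub>0 within M)"
    by (rule has_derivative_transform_open_within)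
      (use V U1 c0 local_retraction_fixes[OF V(1)] grad_T in auto)
  then have D_T: "D v \<in> T" if "v \<in> T" for v
    using has_derivative_unique_on_tangent_space[OF D] that L_T by (metis T_def)
  have Hess: "surface_hess M d c\<^sub>0 v = D v" if "v \<in> T" for v
    using D_T[OF that] closest_point_self
    by (simp add: surface_hess_def grad_def[symmetric] D_def[symmetric] T_def[symmetric])
  have D_bij: "bij_betw D T T"
    using Hess_bij bij_betw_cong[of T "surface_hess M d c\<^sub>0" D T] Hess by blast
  \<comment> \<open>The inverse Hessian is meaningful only on \<open>T\<close>. Extending it to a
    linear map on the whole space makes \<open>B\<close> bounded linear, so that \<open>B\<close>
    can be composed with derivatives.\<close>
  obtain S where S: "linear S" "range S \<subseteq> T" "\<And>v. v \<in> T \<Longrightarrow> S (D v) = v"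
    using linear_exists_left_inverse_on[OF has_derivative_linear[OF D] T] D_bij
    by (auto simp: bij_betw_def)
  define B where "B x = S x - E (S x)" for x
  have B_lin: "bounded_linear B"
    unfolding B_def using S(1) has_derivative_linear[OF E] linear_compose[of S E]
    by (auto simp: linear_conv_bounded_linear[symmetric] o_def intro!: linear_compose_sub)
  have B_T: "B x \<in> T" for x
    using S(2) E_T T by (auto simp: B_def intro!: subspace_diff)
  have B: "return_operator C \<Omega> c\<^sub>0 x = B x" if "x \<in> T" for x
  proof -
    obtain v where v: "v \<in> T" "x = D v"
      using D_bij \<open>x \<in> T\<close> by (auto simp: bij_betw_def)
    have "inv_into T (surface_hess M d c\<^sub>0) x = v"
      using inv_into_f_eq[of "surface_hess M d c\<^sub>0" T v x] Hess_bij Hess v by (auto simp: bij_betw_def)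
    then show ?thesis
      using S(3) v
      by (simp add: return_operator_def Let_def B_def M_def[symmetric] d_def[symmetric]
          F_def[symmetric] T_def[symmetric] E_def[symmetric])
  qed

  \<comment> \<open>Derivatives in local coordinates\<close>
  have \<phi>: "local_coordinates M c\<^sub>0 U \<phi>"
    using assms(15) by (simp add: M_def)
  then have U: "open U" "c\<^sub>0 \<in> U" and \<phi>0: "\<phi> c\<^sub>0 = 0" and \<phi>_C2: "C2_on (M \<inter> U) \<phi>"
    and \<phi>_id: "\<And>v. v \<in> T \<Longrightarrow> surface_deriv M \<phi> c\<^sub>0 v = v"
    by (auto simp: local_coordinates_def C2_diffeo_def T_def)
  have \<phi>_T: "\<phi> ` (M \<inter> U) \<subseteq> T"
    using \<phi> openin_imp_subset by (metis local_coordinates_def T_def)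
  obtain U2 \<phi>' where U2: "open U2" "c\<^sub>0 \<in> U2" and d\<phi>': "\<phi>' differentiable at c\<^sub>0"
    and \<phi>'_ball: "\<forall>x\<in>M \<inter> U \<inter> U2. (\<phi> has_derivative blinfun_apply (\<phi>' x)) (at x within M \<inter> U)"
    using C2_on_has_derivative[OF \<phi>_C2, of c\<^sub>0] c0 U by blast
  note \<phi>'_U = bspec[OF \<phi>'_ball]
  have \<phi>': "(\<phi> has_derivative \<phi>' x) (at x within M)" if "x \<in> M \<inter> U \<inter> U2" for x
    using \<phi>'_U[OF that] that U at_within_nhd[of x U "M \<inter> U" M] by auto
  have \<phi>'_id: "\<phi>' c\<^sub>0 v = v" if "v \<in> T" for v
    using surface_deriv_eq[OF \<phi>', of c\<^sub>0 v] \<phi>_id that c0 U U2 by (simp add: T_def)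

  define X where "X c = surface_deriv M \<phi> c (grad c)" for c
  have X_eq: "X c = \<phi>' c (grad c)" if "c \<in> M \<inter> U \<inter> U1 \<inter> U2" for c
    using surface_deriv_eq[OF \<phi>' grad_T] that by (simp add: X_def)
  have X_T: "X c \<in> T" if "c \<in> M \<inter> U \<inter> U1 \<inter> U2" for c
  proof -
    have "grad c \<in> tangent_space (M \<inter> U) c"
      using grad_T tangent_space_Int_open[of U c M] that U by auto
    then have "\<phi>' c (grad c) \<in> tangent_space T (\<phi> c)"
      using has_derivative_into_tangent_space[OF \<phi>'_U _ \<phi>_T] that by blast
    then show ?thesis
      using tangent_space_subset_subspace[OF T order_refl] X_eq[OF that] by auto
  qed
  obtain D\<phi> where D\<phi>: "(\<phi>' has_derivative D\<phi>) (at c\<^sub>0 within M)"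
    using differentiable_at_withinI[OF d\<phi>'] unfolding differentiable_def by blast
  \<comment> \<open>The vanishing gradient again removes the term with the second derivative of the
    chart. After composition with \<open>L\<close>, the remaining \<open>\<phi>' c\<^sub>0\<close>
    acts on \<open>T\<close>, where it is the identity.\<close>
  have "((\<lambda>c. \<phi>' c (grad c)) has_derivative (\<lambda>h. \<phi>' c\<^sub>0 (D h))) (at c\<^sub>0 within M)"
    using blinfun.FDERIV[OF D\<phi> D] grad0 by simp
  moreover have "open (U \<inter> U1 \<inter> U2)"
    using U U1 U2 by auto
  ultimately have X_deriv0: "(X has_derivative (\<lambda>h. \<phi>' c\<^sub>0 (D h))) (at c\<^sub>0 within M)"
    by (rule has_derivative_transform_open_within) (use U U1 U2 c0 X_eq in auto)
  have X_deriv: "(X has_derivative (\<lambda>h. D (L h))) (at c\<^sub>0 within M)"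
    using via_L[OF X_deriv0] \<phi>'_id[OF D_T[OF L_T]] by simp
  have \<phi>_deriv0: "(\<phi> has_derivative \<phi>' c\<^sub>0) (at c\<^sub>0 within M)"
    using \<phi>' c0 U U2 by simp
  have \<phi>_deriv: "(\<phi> has_derivative L) (at c\<^sub>0 within M)"
    using via_L[OF \<phi>_deriv0] \<phi>'_id[OF L_T] by simp
  have \<phi>F_deriv0: "((\<lambda>c. \<phi> (F c)) has_derivative (\<lambda>h. \<phi>' c\<^sub>0 (E h))) (at c\<^sub>0 within M)"
    using has_derivative_in_compose[OF E] has_derivative_subset[OF \<phi>_deriv0 F_M] F0 by simp
  have \<phi>F_deriv: "((\<lambda>c. \<phi> (F c)) has_derivative (\<lambda>h. E (L h))) (at c\<^sub>0 within M)"
    using via_L[OF \<phi>F_deriv0] \<phi>'_id[OF E_T[OF L_T]] by simp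

  \<comment> \<open>The remainder and its order\<close>
  define R where "R c = \<phi> (F c) - \<phi> c + return_operator C \<Omega> c\<^sub>0 (X c)" for c
  have "((\<lambda>c. \<phi> (F c) - \<phi> c + B (X c)) has_derivative (\<lambda>h. E (L h) - L h + B (D (L h)))) (at c\<^sub>0 within M)"
    by (intro derivative_intros \<phi>F_deriv \<phi>_deriv bounded_linear.has_derivative[OF B_lin] X_deriv)
  \<comment> \<open>As \<open>S\<close> inverts \<open>D\<close> on \<open>T\<close>, the last term
    \<open>B (D (L h))\<close> equals \<open>L h - E (L h)\<close> and cancels the others.\<close>
  then have "((\<lambda>c. \<phi> (F c) - \<phi> c + B (X c)) has_derivative (\<lambda>h. 0)) (at c\<^sub>0 within M)"
    using S(3) L_T by (simp add: B_def)
  then have R_deriv: "(R has_derivative (\<lambda>h. 0)) (at c\<^sub>0 within M)"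
    by (rule has_derivative_transform_open_within[OF _ \<open>open (U \<inter> U1 \<inter> U2)\<close>])
      (use U U1 U2 c0 B X_T in \<open>auto simp: R_def\<close>)
  have "X c\<^sub>0 = 0"
    using X_eq c0 U U1 U2 grad0 by simp
  then have R0: "R c\<^sub>0 = 0"
    using B[of 0] F0 subspace_0[OF T] bounded_linear.linear[OF B_lin] by (simp add: R_def linear_0)
  have "(F \<longlongrightarrow> c\<^sub>0) (at c\<^sub>0 within M)"
    using has_derivative_continuous[OF E] F0 by (simp add: continuous_within)
  then have "\<forall>\<^sub>F c in at c\<^sub>0 within M. F c \<in> U"
    using U topological_tendstoD by blast
  then obtain O' where O': "open O'" "c\<^sub>0 \<in> O'" "\<And>c. c \<in> O' \<Longrightarrow> c \<noteq> c\<^sub>0 \<Longrightarrow> c \<in> M \<Longrightarrow> F c \<in> U"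
    unfolding eventually_at_topological by blast
  define W where "W = O' \<inter> U \<inter> U1 \<inter> U2"
  have W: "open W" "c\<^sub>0 \<in> W" "W \<subseteq> U"
    using O' U U1 U2 by (auto simp: W_def)
  have FU: "F c \<in> U" if "c \<in> M \<inter> W" for c
    using that O'(3) F0 U by (cases "c = c\<^sub>0") (auto simp: W_def)
  have R_T: "R c \<in> T" if "c \<in> M \<inter> W" for c
  proof -
    have "\<phi> (F c) \<in> T" "\<phi> c \<in> T"
      using \<phi>_T FU[OF that] F_M W that by auto
    moreover have "return_operator C \<Omega> c\<^sub>0 (X c) \<in> T"
      using B X_T B_T that by (auto simp: W_def)
    ultimately show ?thesis
      using T by (auto simp: R_def intro!: subspace_add subspace_diff)
  qed
  have "(\<lambda>c. norm (R c)) \<in> o[at c\<^sub>0 within M](\<lambda>c. norm (\<phi> c))"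
  proof (rule landau_o.smallI)
    fix e :: real assume e: "e > 0"
    \<comment> \<open>The identity and the chart share the derivative \<open>L\<close> within
      \<open>M\<close>. The constant \<open>1 / 2\<close> below then bounds
      \<open>norm (c - c\<^sub>0)\<close> by twice \<open>norm (\<phi> c)\<close>, which passes from
      ambient distance to coordinates.\<close>
    have "((\<lambda>c. c - \<phi> c) has_derivative (\<lambda>h. 0)) (at c\<^sub>0 within M)"
      using has_derivative_diff[OF L_id \<phi>_deriv] by simp
    then obtain \<delta> where \<delta>: "\<delta> > 0"
      "\<And>c. c \<in> M \<Longrightarrow> norm (c - c\<^sub>0) < \<delta> \<Longrightarrow> norm (c - \<phi> c - c\<^sub>0) \<le> 1 / 2 * norm (c - c\<^sub>0)"
      unfolding has_derivative_within_alt using \<phi>0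
      by (elim conjE allE[of _ "1 / 2"]) auto
    obtain \<delta>' where \<delta>': "\<delta>' > 0"
      "\<And>c. c \<in> M \<Longrightarrow> norm (c - c\<^sub>0) < \<delta>' \<Longrightarrow> norm (R c) \<le> e / 2 * norm (c - c\<^sub>0)"
      using R_deriv e unfolding has_derivative_within_alt
      by (elim conjE allE[of _ "e / 2"]) (auto simp: R0)
    show "\<forall>\<^sub>F c in at c\<^sub>0 within M. norm (norm (R c)) \<le> e * norm (norm (\<phi> c))"
      unfolding eventually_at
    proof (intro exI[of _ "min \<delta> \<delta>'"] conjI ballI impI)
      fix c assume c: "c \<in> M" "c \<noteq> c\<^sub>0 \<and> dist c c\<^sub>0 < min \<delta> \<delta>'"
      have "norm (c - c\<^sub>0) \<le> norm (\<phi> c) + norm (c - \<phi> c - c\<^sub>0)"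
        using norm_triangle_ineq[of "\<phi> c" "c - \<phi> c - c\<^sub>0"] by simp
      then have "norm (c - c\<^sub>0) \<le> 2 * norm (\<phi> c)"
        using \<delta>(2)[of c] c by (simp add: dist_norm)
      then have "e / 2 * norm (c - c\<^sub>0) \<le> e * norm (\<phi> c)"
        using mult_left_mono[of "norm (c - c\<^sub>0)" "2 * norm (\<phi> c)" "e / 2"] e by simp
      then show "norm (norm (R c)) \<le> e * norm (norm (\<phi> c))"
        using \<delta>'(2)[of c] c by (simp add: dist_norm)
    qed (use \<delta> \<delta>' in auto)
  qed
  moreover have "\<phi> (F c) = \<phi> c - return_operator C \<Omega> c\<^sub>0 (X c) + R c" for c
    by (simp add: R_def)
  ultimately show ?thesis
    using W FU R_T unfolding X_def F_def T_def M_def grad_def d_def by blast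
qed

end
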